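(* Let $n \geq 2$ and let $D \subset \mathbb{C}^n$ be a bounded visibility domain (with respect to the Kobayashi distance). Let $A \subset D$ be a non-empty compact set with the following properties: (1) $\mathcal{H}^{2n-2}(A) = 0$; (2) any Lipschitz map $\phi : I \to A$, where $I$ is an interval in $\mathbb{R}$, is constant. Let $\Omega := D \setminus A$. Then $\Omega$ is a visibility domain that is not pseudoconvex. In particular, $\Omega$ is not Kobayashi complete.
   Context: A domain is a non-empty connected open set. For $s \geq 0$, $\mathcal{H}^s$ denotes the $s$-dimensional Hausdorff measure (with respect to the Euclidean distance); Lipschitz is with respect to the Euclidean distance. For a domain $\Omega \subset \mathbb{C}^n$, $K_\Omega$ denotes the Kobayashi pseudodistance on $\Omega$ and $k_\Omega : \Omega \times \mathbb{C}^n \to [0,\infty)$ the Kobayashi(--Royden) pseudometric, $k_\Omega(z;v) = \inf\{|\zeta| : \exists\, f:\mathbb{D}\to\Omega \text{ holomorphic},\ f(0)=z,\ f'(0)\zeta = v\}$, where $\mathbb{D}$ is the open unit disc (so $K_\Omega$ is the integrated form of $k_\Omega$). When $\Omega$ is bounded, $K_\Omega$ is a genuine distance. $\Omega$ is called Kobayashi complete if the metric space $(\Omega, K_\Omega)$ is Cauchy-complete. Almost-geodesics: let $I \subset \mathbb{R}$ be an interval, $\lambda \geq 1$, $\kappa \geq 0$. A curve $\sigma : I \to \Omega$ is a $(\lambda,\kappa)$-almost-geodesic if (i) $\lambda^{-1}|t-s| - \kappa \leq K_\Omega(\sigma(s),\sigma(t)) \leq \lambda|t-s| + \kappa$ for all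 $s,t \in I$, and (ii) $\sigma$ is absolutely continuous (so $\sigma'(t)$ exists for almost every $t\in I$) and $k_\Omega(\sigma(t);\sigma'(t)) \leq \lambda$ for almost every $t \in I$. Visibility domain: a bounded domain $\Omega \subset \mathbb{C}^n$ is a visibility domain (with respect to the Kobayashi distance) if for any $\lambda \geq 1$, $\kappa \geq 0$, each pair of distinct points $\xi,\eta \in \partial\Omega$, and each pair of relatively open subsets $V_\xi, V_\eta$ of $\overline{\Omega}$ that are neighbourhoods of $\xi,\eta$ respectively with $\overline{V_\xi} \cap \overline{V_\eta} = \emptyset$, there exists a compact subset $K \subset \Omega$ such that the image of any $(\lambda,\kappa)$-almost-geodesic $\sigma : [a,b] \to \Omega$ with $\sigma(a) \in V_\xi$, $\sigma(b) \in V_\eta$ intersects $K$. Pseudoconvex is in the usual sense (equivalently, being a domain of holomorphy). *)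

theory Defs
  imports "HOL-Complex_Analysis.Complex_Analysis"
begin

section \<open>Hausdorff measure\<close>

text \<open>The conventions are that the empty set has weight 0 for every \<open>s\<close> and that a non-empty set
  has weight 1 for \<open>s = 0\<close>; the latter has to be spelled out because \<open>0 powr 0 = 0\<close>. No
  normalising constant is used.\<close>

definition hausdorff_weight :: "real \<Rightarrow> 'a::metric_space set \<Rightarrow> ennreal" where
  "hausdorff_weight s U =
     (if U = {} then 0 else if s = 0 then 1 else ennreal (diameter U powr s))"

definition hausdorff_pre_measure :: "real \<Rightarrow> real \<Rightarrow> 'a::metric_space set \<Rightarrow> ennreal" where
  "hausdorff_pre_measure s \<delta> A =
     (INF U \<in> {U :: nat \<Rightarrow> 'a set. A \<subseteq> (\<Union>i. U i) \<and> (\<forall>i. bounded (U i) \<and> diameter (U i) \<le> \<delta>)}.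
        \<Sum>i. hausdorff_weight s (U i))"

definition hausdorff_measure :: "real \<Rightarrow> 'a::metric_space set \<Rightarrow> ennreal" where
  "hausdorff_measure s A = (SUP \<delta> \<in> {0<..}. hausdorff_pre_measure s \<delta> A)"

section \<open>The Kobayashi pseudometric and pseudodistance\<close>

definition is_domain :: "'a::topological_space set \<Rightarrow> bool" where
  "is_domain \<Omega> \<longleftrightarrow> open \<Omega> \<and> connected \<Omega> \<and> \<Omega> \<noteq> {}"

definition holomorphic_disc :: "(complex ^ 'n) set \<Rightarrow> (complex \<Rightarrow> complex ^ 'n) \<Rightarrow> bool" where
  "holomorphic_disc \<Omega> f \<longleftrightarrow>
     (\<forall>i. (\<lambda>\<zeta>. f \<zeta> $ i) holomorphic_on ball 0 1) \<and> f ` ball 0 1 \<subseteq> \<Omega>"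

definition kobayashi_metric :: "(complex ^ 'n) set \<Rightarrow> complex ^ 'n \<Rightarrow> complex ^ 'n \<Rightarrow> real" where
  "kobayashi_metric \<Omega> z v =
     Inf {cmod \<zeta> | \<zeta>. \<exists>f. holomorphic_disc \<Omega> f \<and> f 0 = z \<and>
                        \<zeta> *s (\<chi> i. deriv (\<lambda>\<omega>. f \<omega> $ i) 0) = v}"

text \<open>The Poincare distance of the unit disc, normalised so that its infinitesimal form is
  \<open>|d\<zeta>| / (1 - |\<zeta>|^2)\<close>. This is the normalisation for which the Kobayashi pseudodistance is the
  integrated form of \<open>kobayashi_metric\<close>.\<close>

definition poincare_dist :: "complex \<Rightarrow> complex \<Rightarrow> real" where
  "poincare_dist a b = artanh (cmod ((a - b) / (1 - cnj a * b)))"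

text \<open>The lengths of the chains of holomorphic discs that join \<open>z\<close> to \<open>w\<close>.\<close>

definition disc_chain_lengths ::
    "(complex ^ 'n) set \<Rightarrow> complex ^ 'n \<Rightarrow> complex ^ 'n \<Rightarrow> real set" where
  "disc_chain_lengths \<Omega> z w =
     {(\<Sum>j<m. poincare_dist (a j) (b j)) | (m::nat) a b.
        \<exists>p f. p 0 = z \<and> p m = w \<and>
          (\<forall>j<m. holomorphic_disc \<Omega> (f j) \<and> a j \<in> ball 0 1 \<and> b j \<in> ball 0 1 \<and>
                 f j (a j) = p j \<and> f j (b j) = p (Suc j))}"

text \<open>The value 0 off \<open>\<Omega>\<close> is a dummy: \<open>Metric_space\<close> asks for a distance function that is
  non-negative and symmetric on the whole type.\<close>

definition kobayashi_dist :: "(complex ^ 'n) set \<Rightarrow> complex ^ 'n \<Rightarrow> complex ^ 'n \<Rightarrow> real" where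
  "kobayashi_dist \<Omega> z w =
     (if z \<in> \<Omega> \<and> w \<in> \<Omega> then Inf (disc_chain_lengths \<Omega> z w) else 0)"

definition kobayashi_complete :: "(complex ^ 'n) set \<Rightarrow> bool" where
  "kobayashi_complete \<Omega> \<longleftrightarrow> Metric_space.mcomplete \<Omega> (kobayashi_dist \<Omega>)"

section \<open>Almost-geodesics and visibility\<close>

definition absolutely_continuous_on ::
    "real set \<Rightarrow> (real \<Rightarrow> 'a::real_normed_vector) \<Rightarrow> bool" where
  "absolutely_continuous_on I f \<longleftrightarrow>
     (\<forall>\<epsilon>>0. \<exists>\<delta>>0. \<forall>(m::nat) a b.
        (\<forall>j<m. a j \<le> b j \<and> {a j..b j} \<subseteq> I) \<and>
        (\<forall>i<m. \<forall>j<m. i \<noteq> j \<longrightarrow> {a i<..<b i} \<inter> {a j<..<b j} = {}) \<and>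
        (\<Sum>j<m. b j - a j) < \<delta>
        \<longrightarrow> (\<Sum>j<m. norm (f (b j) - f (a j))) < \<epsilon>)"

text \<open>The almost-everywhere existence of the derivative follows from absolute continuity. It is
  restated so that the bound on the derivative never concerns an unspecified value.\<close>

definition almost_geodesic ::
    "(complex ^ 'n) set \<Rightarrow> real \<Rightarrow> real \<Rightarrow> real set \<Rightarrow> (real \<Rightarrow> complex ^ 'n) \<Rightarrow> bool" where
  "almost_geodesic \<Omega> l \<kappa> I \<sigma> \<longleftrightarrow>
     is_interval I \<and> \<sigma> ` I \<subseteq> \<Omega> \<and>
     (\<forall>s\<in>I. \<forall>t\<in>I. inverse l * \<bar>t - s\<bar> - \<kappa> \<le> kobayashi_dist \<Omega> (\<sigma> s) (\<sigma> t) \<and>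
                   kobayashi_dist \<Omega> (\<sigma> s) (\<sigma> t) \<le> l * \<bar>t - s\<bar> + \<kappa>) \<and>
     absolutely_continuous_on I \<sigma> \<and>
     (AE t in lebesgue. t \<in> I \<longrightarrow>
        \<sigma> differentiable (at t within I) \<and>
        kobayashi_metric \<Omega> (\<sigma> t) (vector_derivative \<sigma> (at t within I)) \<le> l)"

definition visibility_domain :: "(complex ^ 'n) set \<Rightarrow> bool" where
  "visibility_domain \<Omega> \<longleftrightarrow>
     is_domain \<Omega> \<and> bounded \<Omega> \<and>
     (\<forall>l \<kappa> \<xi> \<eta> V W.
        1 \<le> l \<and> 0 \<le> \<kappa> \<and>
        \<xi> \<in> frontier \<Omega> \<and> \<eta> \<in> frontier \<Omega> \<and> \<xi> \<noteq> \<eta> \<and>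
        openin (top_of_set (closure \<Omega>)) V \<and> openin (top_of_set (closure \<Omega>)) W \<and>
        \<xi> \<in> V \<and> \<eta> \<in> W \<and> closure V \<inter> closure W = {}
        \<longrightarrow> (\<exists>K. compact K \<and> K \<subseteq> \<Omega> \<and>
              (\<forall>a b \<sigma>. a \<le> b \<and> almost_geodesic \<Omega> l \<kappa> {a..b} \<sigma> \<and> \<sigma> a \<in> V \<and> \<sigma> b \<in> W
                 \<longrightarrow> \<sigma> ` {a..b} \<inter> K \<noteq> {})))"

section \<open>Pseudoconvexity\<close>

text \<open>Plurisubharmonicity of a continuous real-valued function on an open set: the sub-mean value
  inequality holds on the closed disc \<open>{z + \<zeta> w | |\<zeta>| \<le> 1}\<close> in each complex line whenever that
  disc lies in \<open>\<Omega>\<close>.\<close>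

definition continuous_psh_on :: "(complex ^ 'n) set \<Rightarrow> (complex ^ 'n \<Rightarrow> real) \<Rightarrow> bool" where
  "continuous_psh_on \<Omega> u \<longleftrightarrow>
     continuous_on \<Omega> u \<and>
     (\<forall>z w. (\<forall>\<zeta>\<in>cball 0 1. z + \<zeta> *s w \<in> \<Omega>) \<longrightarrow>
        u z \<le> 1 / (2 * pi) * integral {0..2 * pi} (\<lambda>\<theta>. u (z + cis \<theta> *s w)))"

text \<open>Existence of a continuous plurisubharmonic exhaustion function; meant for open \<open>\<Omega>\<close>.\<close>

definition pseudoconvex :: "(complex ^ 'n) set \<Rightarrow> bool" where
  "pseudoconvex \<Omega> \<longleftrightarrow>
     (\<exists>u. continuous_psh_on \<Omega> u \<and>
        (\<forall>c. compact (closure {z\<in>\<Omega>. u z < c}) \<and> closure {z\<in>\<Omega>. u z < c} \<subseteq> \<Omega>))"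

end

theory Submission
  imports Defs
begin

text \<open>A compact set \<open>A\<close> of zero \<open>(2n - 2)\<close>-dimensional measure is missed by almost every translate of a
  holomorphic disc, because the set of bad translations is a Lipschitz image of (disc) \<open>\<times> A\<close> in real dimension \<open>2n\<close>. Translating
  a whole chain of discs in \<open>D\<close> by one small generic vector shows that the Kobayashi distances of \<open>D\<close>
  and \<open>D - A\<close> agree on \<open>D - A\<close>, so almost-geodesics of \<open>D - A\<close> are almost-geodesics of \<open>D\<close>.

  If visibility of \<open>D - A\<close> fails, there are almost-geodesics that stay ever closer to the complement
  of \<open>D\<close> or to \<open>A\<close>. The first contradicts visibility of \<open>D\<close>. In the second case they are uniformly
  Lipschitz with bounded parameter intervals, and a limit is a nonconstant Lipschitz curve in \<open>A\<close>.

  A disc that meets \<open>A\<close> only in its centre is a limit of discs in \<open>D - A\<close>, so the maximum principle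
  rules out a plurisubharmonic exhaustion. A sequence in \<open>D - A\<close> that converges to a point of \<open>A\<close> is
  Cauchy for the Kobayashi distance of \<open>D\<close>, hence for that of \<open>D - A\<close>.\<close>

section \<open>Hausdorff null sets and Lipschitz images\<close>

text \<open>The exponent \<open>2 * n - 2\<close> is dictated by a count: a disc contributes two
  real dimensions, and nullity in dimension \<open>2 * n - 2\<close> makes the bad vectors null in
  dimension \<open>2 * n\<close>. Translations are used, rather than perturbations of each disc,
  because one common vector keeps the end points of consecutive discs together. The price is that
  the two outer end points move as well; they lie in the open set \<open>D - A\<close>, where the
  distance is continuous, so this costs arbitrarily little. Equality of the distances is what bounds
  the parameter intervals: a priori the distance of \<open>D - A\<close> could blow up near
  \<open>A\<close>, but the distance of \<open>D\<close> is bounded on a compact neighbourhood of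
  \<open>A\<close>. For the infinitesimal metric the inequality given by inclusion already has the
  right direction. A single curve may run close to \<open>A\<close> for some time and close to the
  complement of \<open>D\<close> at other times, so the two limiting cases do not simply exhaust the
  possibilities. They do so by connectedness, since \<open>A\<close> has positive distance from the
  complement of \<open>D\<close>.\<close>

lemma hausdorff_null_cover:
  fixes A :: "'a::metric_space set"
  assumes "hausdorff_measure s A = 0" "0 < s" "0 < e"
  obtains U :: "nat \<Rightarrow> 'a set" and d :: "nat \<Rightarrow> real"
  where "A \<subseteq> (\<Union>i. U i)" "\<And>i. bounded (U i)" "\<And>i. diameter (U i) \<le> d i"
    "\<And>i. 0 < d i" "\<And>i. d i \<le> 1" "(\<Sum>i. ennreal (d i powr s)) < ennreal e"
proof -
  have "hausdorff_pre_measure s 1 A \<le> hausdorff_measure s A"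
    unfolding hausdorff_measure_def by (rule SUP_upper) auto
  then have "hausdorff_pre_measure s 1 A < ennreal (e / 2)"
    using assms by simp
  then obtain U :: "nat \<Rightarrow> 'a set" where U: "A \<subseteq> (\<Union>i. U i)"
      "\<And>i. bounded (U i)" "\<And>i. diameter (U i) \<le> 1"
      "(\<Sum>i. hausdorff_weight s (U i)) < ennreal (e / 2)"
    unfolding hausdorff_pre_measure_def INF_less_iff by blast
  \<comment> \<open>The factor \<open>(1/2) ^ (i + 2)\<close> makes the \<open>q i\<close> sum to
    \<open>e / 2\<close>, the half of the budget that the cover leaves.\<close>
  define q where "q i = e * (1/2) ^ (i + 2)" for i :: nat
  have q: "0 < q i" for i using \<open>0 < e\<close> by (simp add: q_def)
  \<comment> \<open>Pieces of diameter 0, such as single points, get an artificial positive size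
    whose weight is at most \<open>q i\<close>. Later the sizes are divided by, as mesh widths of
    grids.\<close>
  define d where
    "d i = (if 0 < diameter (U i) then diameter (U i) else min 1 (q i powr (1 / s)))" for i
  have d0: "0 < d i" for i using q[of i] by (auto simp: d_def)
  have le: "ennreal (d i powr s) \<le> hausdorff_weight s (U i) + ennreal (q i)" for i
  proof (cases "0 < diameter (U i)")
    case True
    then have "U i \<noteq> {}" by auto
    with True \<open>0 < s\<close> show ?thesis
      by (simp add: d_def hausdorff_weight_def)
  next
    case False
    have "d i powr s \<le> (q i powr (1 / s)) powr s"
      using False d0[of i] \<open>0 < s\<close> by (intro powr_mono2) (auto simp: d_def)
    also have "\<dots> = q i" using q[of i] \<open>0 < s\<close> by (simp add: powr_powr)
    finally show ?thesis
      by (metis add.left_neutral add_mono ennreal_leI zero_le)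
  qed
  have "(\<lambda>i. (e/4) * (1/2) ^ i) sums ((e/4) * (1 / (1 - 1/2)))"
    by (intro sums_mult geometric_sums) auto
  then have "q sums (e / 2)"
    by (simp add: q_def[abs_def] power_add field_simps)
  then have qs: "(\<Sum>i. ennreal (q i)) = ennreal (e / 2)"
    using q by (intro suminf_ennreal_eq) (auto intro: less_imp_le)
  have "(\<Sum>i. ennreal (d i powr s)) \<le> (\<Sum>i. hausdorff_weight s (U i) + ennreal (q i))"
    by (intro suminf_le le) auto
  also have "\<dots> = ennreal (e / 2) + (\<Sum>i. hausdorff_weight s (U i))"
    by (subst suminf_add[symmetric]) (auto simp: qs add.commute)
  also have "\<dots> < ennreal (e / 2) + ennreal (e / 2)"
    unfolding ennreal_add_left_cancel_less using U(4) by simp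
  also have "\<dots> = ennreal e"
    using \<open>0 < e\<close> by (simp flip: ennreal_plus)
  finally have "(\<Sum>i. ennreal (d i powr s)) < ennreal e" .
  moreover have "diameter (U i) \<le> d i" "d i \<le> 1" for i
    using U(3)[of i] d0[of i]
    by (auto simp: d_def not_less intro: order_trans[of _ 0 "q i powr (1 / s)"])
  ultimately show ?thesis using that U d0 by blast
qed

text \<open>A square grid of mesh \<open>1 / N\<close> with \<open>1 / d \<le> N \<le> 2 / d\<close>
  serves; it has \<open>(2 R N + 1)\<^sup>2 \<le> (3 R N)\<^sup>2\<close> points, which gives the 6.
  The growth like \<open>1 / d\<^sup>2\<close> is the real dimension 2 of the disc in the volume
  count.\<close>

lemma complex_grid_cover:
  assumes "0 < d" "d \<le> 1" "1 \<le> (R::nat)"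
  obtains G :: "complex set" where "finite G" "real (card G) \<le> (6 * real R)\<^sup>2 / d\<^sup>2"
    "\<And>z. cmod z \<le> real R \<Longrightarrow> \<exists>g\<in>G. dist z g \<le> 2 * d"
proof -
  define N where "N = nat \<lceil>1 / d\<rceil>"
  have N1: "1 / d \<le> real N" unfolding N_def by linarith
  have N2: "real N \<le> 2 / d"
  proof -
    have "real N \<le> 1 / d + 1" unfolding N_def using \<open>0 < d\<close> by (smt (verit) of_nat_nat ceiling_correct divide_pos_pos zero_less_ceiling)
    also have "\<dots> \<le> 2 / d" using assms by (simp add: field_simps)
    finally show ?thesis .
  qed
  have "0 < 1 / d" using \<open>0 < d\<close> by simp
  then have N0: "0 < real N" using N1 by linarith
  define S where "S = {- int (R * N)..int (R * N)}"
  define G where "G = (\<lambda>(j, k). Complex (of_int j / real N) (of_int k / real N)) ` (S \<times> S)"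
  have "finite G" by (simp add: G_def S_def)
  moreover have "real (card G) \<le> (6 * real R)\<^sup>2 / d\<^sup>2"
  proof -
    have "card G \<le> card (S \<times> S)" unfolding G_def by (rule card_image_le) (simp add: S_def)
    also have "\<dots> = (2 * (R * N) + 1)\<^sup>2"
      by (simp add: S_def card_cartesian_product power2_eq_square nat_add_distrib nat_mult_distrib)
    finally have "real (card G) \<le> (2 * (real R * real N) + 1)\<^sup>2"
      by (metis (mono_tags, opaque_lifting) of_nat_1 of_nat_add of_nat_le_iff of_nat_mult of_nat_numeral of_nat_power)
    also have "\<dots> \<le> (3 * (real R * real N))\<^sup>2"
    proof (rule power_mono)
      have "1 \<le> N" using N0 by simp
      then have "1 \<le> R * N" using \<open>1 \<le> R\<close> by simp
      then have "1 \<le> real R * real N" by (metis of_nat_1 of_nat_le_iff of_nat_mult)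
      then show "2 * (real R * real N) + 1 \<le> 3 * (real R * real N)" by linarith
    qed simp
    also have "\<dots> \<le> (3 * (real R * (2 / d)))\<^sup>2"
      using N2 by (intro power_mono mult_left_mono) auto
    also have "\<dots> = (6 * real R)\<^sup>2 / d\<^sup>2" by (simp add: power2_eq_square)
    finally show ?thesis .
  qed
  moreover have "\<exists>g\<in>G. dist z g \<le> 2 * d" if z: "cmod z \<le> real R" for z
  proof -
    have fl: "\<lfloor>real N * x\<rfloor> \<in> S \<and> \<bar>x - of_int \<lfloor>real N * x\<rfloor> / real N\<bar> \<le> d"
      if x: "\<bar>x\<bar> \<le> real R" for x
    proof
      have "\<bar>real N * x\<bar> \<le> real (R * N)"
        using x N0 by (simp add: abs_mult mult.commute mult_right_mono)
      then show "\<lfloor>real N * x\<rfloor> \<in> S" unfolding S_def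
        by (simp add: floor_le_iff le_floor_iff abs_le_iff)
      have "\<bar>real N * x - of_int \<lfloor>real N * x\<rfloor>\<bar> \<le> 1" by linarith
      then have "\<bar>x - of_int \<lfloor>real N * x\<rfloor> / real N\<bar> \<le> 1 / real N"
      proof -
        have "x - of_int \<lfloor>real N * x\<rfloor> / real N = (real N * x - of_int \<lfloor>real N * x\<rfloor>) / real N"
          using N0 by (simp add: field_simps)
        then show ?thesis using \<open>\<bar>real N * x - of_int \<lfloor>real N * x\<rfloor>\<bar> \<le> 1\<close>
          by (simp add: abs_divide divide_right_mono)
      qed
      also have "\<dots> \<le> d" using N1 N0 \<open>0 < d\<close> by (simp add: field_simps)
      finally show "\<bar>x - of_int \<lfloor>real N * x\<rfloor> / real N\<bar> \<le> d" .
    qed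
    let ?g = "Complex (of_int \<lfloor>real N * Re z\<rfloor> / real N) (of_int \<lfloor>real N * Im z\<rfloor> / real N)"
    have b: "\<bar>Re z\<bar> \<le> real R" "\<bar>Im z\<bar> \<le> real R"
      using z abs_Re_le_cmod[of z] abs_Im_le_cmod[of z] by linarith+
    have "?g \<in> G" unfolding G_def using fl[OF b(1)] fl[OF b(2)] by auto
    moreover have "dist z ?g \<le> 2 * d"
      using cmod_le[of "z - ?g"] fl[OF b(1)] fl[OF b(2)] by (simp add: dist_norm)
    ultimately show ?thesis by blast
  qed
  ultimately show ?thesis using that by blast
qed

text \<open>If \<open>U\<close> has diameter \<open>d\<close> then \<open>B \<times> U\<close> is covered by \<open>O(1/d\<^sup>2)\<close> sets of diameter \<open>O(d)\<close>,
  whose images have total volume \<open>O(d\<^sup>s)\<close>.\<close>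

lemma negligible_lipschitz_image_hausdorff_null:
  fixes \<Phi> :: "complex \<Rightarrow> 'a::metric_space \<Rightarrow> 'b::euclidean_space"
  assumes null: "hausdorff_measure s A = 0" and s: "0 < s" and dim: "real DIM('b) = s + 2"
    and "bounded B" and "0 \<le> L"
    and lip: "\<And>\<zeta> \<zeta>' a a'. \<zeta> \<in> B \<Longrightarrow> \<zeta>' \<in> B \<Longrightarrow> a \<in> A \<Longrightarrow> a' \<in> A \<Longrightarrow>
                dist (\<Phi> \<zeta> a) (\<Phi> \<zeta>' a') \<le> L * (dist \<zeta> \<zeta>' + dist a a')"
  shows "negligible {\<Phi> \<zeta> a | \<zeta> a. \<zeta> \<in> B \<and> a \<in> A}"
proof -
  obtain R0 where R0: "\<And>z. z \<in> B \<Longrightarrow> cmod z \<le> R0"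
    using \<open>bounded B\<close> by (auto simp: bounded_iff)
  obtain R :: nat where "max 1 R0 \<le> real R" using real_arch_simple by blast
  then have R: "1 \<le> R" "\<And>z. z \<in> B \<Longrightarrow> cmod z \<le> real R" using R0 by force+
  define V where "V = unit_ball_vol (real DIM('b))"
  \<comment> \<open>\<open>(6 R)\<^sup>2 / d\<^sup>2\<close> balls of radius \<open>5 L d\<close> in
    real dimension \<open>s + 2\<close> have total volume at most
    \<open>C * d powr s\<close>.\<close>
  define C where "C = (6 * real R)\<^sup>2 * (V * (5 * L) ^ DIM('b))"
  have "0 \<le> V" by (simp add: V_def)
  then have "0 \<le> C" using \<open>0 \<le> L\<close> by (simp add: C_def)
  show ?thesis
    unfolding negligible_outer_le
  proof (intro allI impI)
    fix e :: real assume "0 < e"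
    then have "0 < e / (C + 1)" using \<open>0 \<le> C\<close> by simp
    from hausdorff_null_cover[OF null s this]
    obtain U :: "nat \<Rightarrow> 'a set" and d :: "nat \<Rightarrow> real"
      where U: "A \<subseteq> (\<Union>i. U i)" "\<And>i. bounded (U i)" "\<And>i. diameter (U i) \<le> d i"
        and d: "\<And>i. 0 < d i" "\<And>i. d i \<le> 1"
        and sum: "(\<Sum>i. ennreal (d i powr s)) < ennreal (e / (C + 1))"
      by metis
    have "\<forall>i. \<exists>G :: complex set. finite G \<and> real (card G) \<le> (6 * real R)\<^sup>2 / (d i)\<^sup>2 \<and>
             (\<forall>z. cmod z \<le> real R \<longrightarrow> (\<exists>g\<in>G. dist z g \<le> 2 * d i))"
      using complex_grid_cover[OF d R(1)] by metis
    then obtain G :: "nat \<Rightarrow> complex set" where G: "\<And>i. finite (G i)"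
        "\<And>i. real (card (G i)) \<le> (6 * real R)\<^sup>2 / (d i)\<^sup>2"
        "\<And>i z. cmod z \<le> real R \<Longrightarrow> \<exists>g\<in>G i. dist z g \<le> 2 * d i"
      by metis
    \<comment> \<open>A grid point \<open>g\<close> need not lie in \<open>B\<close>, where the
      Lipschitz bound holds, so the ball is centred at the image of some admissible pair close to
      \<open>g\<close>; if there is none, the ball is arbitrary and harmless. Two admissible first
      arguments differ by at most \<open>4 * d i\<close>, two points of \<open>U i\<close> by at
      most \<open>d i\<close>, whence the radius \<open>5 * L * d i\<close>.\<close>
    define P where "P i g p \<longleftrightarrow> (\<exists>\<zeta> a. p = \<Phi> \<zeta> a \<and> \<zeta> \<in> B \<and> a \<in> A \<and> a \<in> U i \<and> dist \<zeta> g \<le> 2 * d i)"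
      for i g p
    define T where "T i = (\<Union>g\<in>G i. cball (SOME p. P i g p) (5 * L * d i))" for i
    have sub: "{\<Phi> \<zeta> a | \<zeta> a. \<zeta> \<in> B \<and> a \<in> A} \<subseteq> (\<Union>i. T i)"
    proof clarify
      fix \<zeta> a assume za: "\<zeta> \<in> B" "a \<in> A"
      then obtain i where i: "a \<in> U i" using U(1) by blast
      obtain g where g: "g \<in> G i" "dist \<zeta> g \<le> 2 * d i" using G(3) R(2) za by blast
      then have "P i g (\<Phi> \<zeta> a)" using za i unfolding P_def by blast
      then have "P i g (SOME p. P i g p)" by (rule someI)
      then obtain \<zeta>' a' where p: "(SOME p. P i g p) = \<Phi> \<zeta>' a'" "\<zeta>' \<in> B" "a' \<in> A" "a' \<in> U i"
          "dist \<zeta>' g \<le> 2 * d i"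
        unfolding P_def by blast
      have "dist \<zeta>' \<zeta> \<le> 4 * d i" using p(5) g(2) dist_triangle2[of \<zeta>' \<zeta> g] by linarith
      moreover have "dist a' a \<le> d i"
        using diameter_bounded_bound[OF U(2) p(4) i] U(3)[of i] by linarith
      ultimately have "dist \<zeta>' \<zeta> + dist a' a \<le> 5 * d i" by linarith
      then have "L * (dist \<zeta>' \<zeta> + dist a' a) \<le> L * (5 * d i)"
        using \<open>0 \<le> L\<close> by (rule mult_left_mono)
      with lip[OF p(2) za(1) p(3) za(2)] have "dist (\<Phi> \<zeta>' a') (\<Phi> \<zeta> a) \<le> 5 * L * d i"
        by (simp add: mult_ac)
      then have "\<Phi> \<zeta> a \<in> T i" unfolding T_def using g(1) p(1) by (intro UN_I[of g]) auto
      then show "\<Phi> \<zeta> a \<in> (\<Union>i. T i)" by blast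
    qed
    have Tm: "T i \<in> sets lebesgue" for i
      unfolding T_def using G(1) by (intro sets.finite_UN) auto
    have eT: "emeasure lebesgue (T i) \<le> ennreal (C * d i powr s)" for i
    proof -
      have r0: "0 \<le> 5 * L * d i" using \<open>0 \<le> L\<close> d(1)[of i] by simp
      have "emeasure lebesgue (T i)
          \<le> (\<Sum>g\<in>G i. emeasure lebesgue (cball (SOME p. P i g p) (5 * L * d i)))"
        unfolding T_def using G(1) by (intro emeasure_subadditive_finite) auto
      also have "\<dots> = (\<Sum>g\<in>G i. ennreal (V * (5 * L * d i) ^ DIM('b)))"
        using r0 by (simp add: emeasure_cball V_def)
      also have "\<dots> = ennreal (real (card (G i)) * (V * (5 * L * d i) ^ DIM('b)))"
        using r0 \<open>0 \<le> V\<close> by (simp add: ennreal_mult' ennreal_of_nat_eq_real_of_nat)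
      also have "\<dots> \<le> ennreal ((6 * real R)\<^sup>2 / (d i)\<^sup>2 * (V * (5 * L * d i) ^ DIM('b)))"
        using r0 \<open>0 \<le> V\<close> by (intro ennreal_leI mult_right_mono G) auto
      also have "(6 * real R)\<^sup>2 / (d i)\<^sup>2 * (V * (5 * L * d i) ^ DIM('b))
          = C * (d i ^ DIM('b) / (d i)\<^sup>2)"
        by (simp add: C_def power_mult_distrib)
      also have "d i ^ DIM('b) / (d i)\<^sup>2 = d i powr real DIM('b) / d i powr 2"
        using d(1)[of i] by (simp add: powr_realpow)
      also have "\<dots> = d i powr s"
        using d(1)[of i] by (simp add: dim powr_add)
      finally show ?thesis .
    qed
    have "emeasure lebesgue (\<Union>i. T i) \<le> (\<Sum>i. emeasure lebesgue (T i))"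
      using Tm by (intro emeasure_subadditive_countably) auto
    also have "\<dots> \<le> (\<Sum>i. ennreal (C * d i powr s))"
      by (intro suminf_le eT) auto
    also have "\<dots> = ennreal C * (\<Sum>i. ennreal (d i powr s))"
      using \<open>0 \<le> C\<close> by (simp add: ennreal_mult' ennreal_suminf_cmult)
    also have "\<dots> \<le> ennreal C * ennreal (e / (C + 1))"
      using sum by (intro mult_left_mono) auto
    also have "\<dots> = ennreal (C * (e / (C + 1)))"
      using \<open>0 \<le> C\<close> by (rule ennreal_mult'[symmetric])
    also have "\<dots> \<le> ennreal e"
      using \<open>0 \<le> C\<close> \<open>0 < e\<close> by (intro ennreal_leI) (simp add: field_simps)
    finally have le: "emeasure lebesgue (\<Union>i. T i) \<le> ennreal e" .
    then have "(\<Union>i. T i) \<in> lmeasurable"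
      using Tm by (intro fmeasurableI sets.countable_UN) (auto simp: top.not_eq_extremum intro: le_less_trans)
    moreover have "measure lebesgue (\<Union>i. T i) \<le> e"
      using le \<open>0 < e\<close> by (simp add: measure_def enn2real_leI)
    ultimately show "\<exists>T. {\<Phi> \<zeta> a | \<zeta> a. \<zeta> \<in> B \<and> a \<in> A} \<subseteq> T \<and> T \<in> lmeasurable \<and> measure lebesgue T \<le> e"
      using sub by blast
  qed
qed

section \<open>Absolutely continuous curves\<close>

text \<open>Reindexing along a bijection with an initial segment of the natural numbers. A tagged
  division is a finite set of pairs, and its pieces come without a numbering.\<close>

lemma absolutely_continuous_on_finite_family:
  fixes f :: "real \<Rightarrow> 'a::real_normed_vector"
  assumes "absolutely_continuous_on I f" "0 < e"
  shows "\<exists>d>0. \<forall>(S :: 'i set) a b. finite S \<longrightarrow> (\<forall>i\<in>S. a i \<le> b i \<and> {a i..b i} \<subseteq> I) \<longrightarrow>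
       (\<forall>i\<in>S. \<forall>j\<in>S. i \<noteq> j \<longrightarrow> {a i<..<b i} \<inter> {a j<..<b j} = {}) \<longrightarrow>
       (\<Sum>i\<in>S. b i - a i) < d \<longrightarrow> (\<Sum>i\<in>S. norm (f (b i) - f (a i))) < e"
proof -
  from assms obtain d where "0 < d" and
    d: "\<forall>(m::nat) a b. (\<forall>j<m. a j \<le> b j \<and> {a j..b j} \<subseteq> I) \<and>
        (\<forall>i<m. \<forall>j<m. i \<noteq> j \<longrightarrow> {a i<..<b i} \<inter> {a j<..<b j} = {}) \<and>
        (\<Sum>j<m. b j - a j) < d \<longrightarrow> (\<Sum>j<m. norm (f (b j) - f (a j))) < e"
    unfolding absolutely_continuous_on_def by blast
  show ?thesis
  proof (intro exI[of _ d] conjI allI impI)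
    fix S :: "'i set" and a b
    assume fin: "finite S" and S: "\<forall>i\<in>S. a i \<le> b i \<and> {a i..b i} \<subseteq> I"
      "\<forall>i\<in>S. \<forall>j\<in>S. i \<noteq> j \<longrightarrow> {a i<..<b i} \<inter> {a j<..<b j} = {}"
      "(\<Sum>i\<in>S. b i - a i) < d"
    obtain h where h: "bij_betw h {..<card S} S"
      using ex_bij_betw_nat_finite[OF fin] by (auto simp: atLeast0LessThan)
    have in_S: "h j \<in> S" if "j < card S" for j using h that by (auto simp: bij_betw_def)
    have ne: "h i \<noteq> h j" if "i < card S" "j < card S" "i \<noteq> j" for i j
      using h that by (auto simp: bij_betw_def inj_on_def)
    have 1: "\<forall>j<card S. a (h j) \<le> b (h j) \<and> {a (h j)..b (h j)} \<subseteq> I"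
      using S(1) in_S by blast
    have 2: "\<forall>i<card S. \<forall>j<card S. i \<noteq> j \<longrightarrow> {a (h i)<..<b (h i)} \<inter> {a (h j)<..<b (h j)} = {}"
      using S(2) in_S ne by blast
    have 3: "(\<Sum>j<card S. b (h j) - a (h j)) < d"
      using S(3) by (simp add: sum.reindex_bij_betw[OF h, of "\<lambda>i. b i - a i"])
    have "(\<Sum>j<card S. norm (f (b (h j)) - f (a (h j)))) < e"
      using d[rule_format, of "card S" "\<lambda>j. a (h j)" "\<lambda>j. b (h j)"] 1 2 3 by blast
    then show "(\<Sum>i\<in>S. norm (f (b i) - f (a i))) < e"
      by (simp add: sum.reindex_bij_betw[OF h, of "\<lambda>i. norm (f (b i) - f (a i))"])
  qed (rule \<open>0 < d\<close>)
qed

text \<open>Cousin's lemma: cut the interval into pieces that are either so short around a good point that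
  the derivative controls the increment, or contained in an open set of small measure around the
  exceptional points, where absolute continuity controls the sum of the increments.\<close>

lemma absolutely_continuous_bounded_derivative:
  fixes f :: "real \<Rightarrow> 'a::real_normed_vector"
  assumes ac: "absolutely_continuous_on {a..b} f" and "a \<le> b" "0 \<le> M"
    and ae: "AE t in lebesgue. t \<in> {a..b} \<longrightarrow>
               (\<exists>v. (f has_vector_derivative v) (at t within {a..b}) \<and> norm v \<le> M)"
  shows "norm (f b - f a) \<le> M * (b - a)"
proof (rule field_le_epsilon)
  fix e :: real assume "0 < e"
  \<comment> \<open>The good pieces lose at most \<open>\<epsilon> * (b - a)\<close> altogether and
    the exceptional ones at most \<open>\<epsilon>\<close>.\<close>
  define \<epsilon> where "\<epsilon> = e / (b - a + 1)"
  have \<epsilon>: "0 < \<epsilon>" "\<epsilon> * (b - a + 1) = e" using \<open>0 < e\<close> \<open>a \<le> b\<close> by (auto simp: \<epsilon>_def)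
  obtain d where "0 < d" and d:
    "\<forall>(S :: (real \<times> real set) set) a' b'. finite S \<longrightarrow> (\<forall>i\<in>S. a' i \<le> b' i \<and> {a' i..b' i} \<subseteq> {a..b}) \<longrightarrow>
       (\<forall>i\<in>S. \<forall>j\<in>S. i \<noteq> j \<longrightarrow> {a' i<..<b' i} \<inter> {a' j<..<b' j} = {}) \<longrightarrow>
       (\<Sum>i\<in>S. b' i - a' i) < d \<longrightarrow> (\<Sum>i\<in>S. norm (f (b' i) - f (a' i))) < \<epsilon>"
    using absolutely_continuous_on_finite_family[OF ac \<epsilon>(1)] by blast
  define good where "good t \<longleftrightarrow>
    (\<exists>v. (f has_vector_derivative v) (at t within {a..b}) \<and> norm v \<le> M)" for t
  from ae have "AE t in lebesgue. t \<in> {a..b} \<longrightarrow> good t" unfolding good_def .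
  then obtain N where N: "{t. \<not> (t \<in> {a..b} \<longrightarrow> good t)} \<subseteq> N" "emeasure lebesgue N = 0" "N \<in> sets lebesgue"
    by (auto elim!: AE_E)
  then have "negligible N" by (simp add: negligible_iff_emeasure0)
  then have "negligible ({t\<in>{a..b}. \<not> good t})" by (rule negligible_subset) (use N(1) in auto)
  define bad where "bad = {t\<in>{a..b}. \<not> good t}"
  have "bad \<in> lmeasurable" "measure lebesgue bad = 0"
    using \<open>negligible {t\<in>{a..b}. \<not> good t}\<close> unfolding bad_def negligible_iff_measure by auto
  then obtain W where W: "open W" "bad \<subseteq> W" "W - bad \<in> lmeasurable" "emeasure lebesgue (W - bad) < ennreal d"
    using sets_lebesgue_outer_open[of bad d] \<open>0 < d\<close> by (metis fmeasurableD)
  have Wm: "W \<in> lmeasurable" "measure lebesgue W < d"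
  proof -
    have eq: "W = (W - bad) \<union> bad" using W(2) by blast
    show "W \<in> lmeasurable" by (subst eq) (intro fmeasurable.Un W \<open>bad \<in> lmeasurable\<close>)
    have "measure lebesgue W \<le> measure lebesgue (W - bad) + measure lebesgue bad"
      by (subst eq) (intro measure_Un_le fmeasurableD W \<open>bad \<in> lmeasurable\<close>)
    moreover have "measure lebesgue (W - bad) < d"
      using W(3,4) \<open>0 < d\<close> by (simp add: emeasure_eq_measure2 ennreal_less_iff)
    ultimately show "measure lebesgue W < d" using \<open>measure lebesgue bad = 0\<close> by simp
  qed
  \<comment> \<open>At a good point only intervals that contain it are controlled, which is enough
    because a piece contains its tag. For \<open>x \<le> t \<le> y\<close> the lengths on both sides
    of \<open>t\<close> add up to \<open>y - x\<close>, so nothing is lost in the triangle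
    inequality.\<close>
  define Q where "Q t \<gamma> \<longleftrightarrow> open \<gamma> \<and> t \<in> \<gamma> \<and> (t \<in> bad \<longrightarrow> \<gamma> \<subseteq> W) \<and>
     (t \<notin> bad \<longrightarrow> (\<forall>x y. x \<le> t \<longrightarrow> t \<le> y \<longrightarrow> x \<in> \<gamma> \<longrightarrow> y \<in> \<gamma> \<longrightarrow> a \<le> x \<longrightarrow> y \<le> b \<longrightarrow>
       norm (f y - f x) \<le> (M + \<epsilon>) * (y - x)))" for t \<gamma>
  have "\<exists>\<gamma>. Q t \<gamma>" if t: "t \<in> {a..b}" for t
  proof (cases "t \<in> bad")
    case True then have "Q t W" using W(1,2) unfolding Q_def by blast
    then show ?thesis ..
  next
    case False
    then obtain v where v: "(f has_vector_derivative v) (at t within {a..b})" "norm v \<le> M"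
      using t by (auto simp: bad_def good_def)
    then obtain r where r: "0 < r" "\<And>y. y \<in> {a..b} \<Longrightarrow> norm (y - t) < r \<Longrightarrow>
        norm (f y - f t - (y - t) *\<^sub>R v) \<le> \<epsilon> * norm (y - t)"
      unfolding has_vector_derivative_def has_derivative_within_alt using \<epsilon>(1) by blast
    have step: "norm (f y - f t) \<le> (M + \<epsilon>) * \<bar>y - t\<bar>" if "y \<in> {a..b}" "\<bar>y - t\<bar> < r" for y
    proof -
      have "norm (f y - f t) \<le> norm (f y - f t - (y - t) *\<^sub>R v) + norm ((y - t) *\<^sub>R v)"
        by (metis diff_add_cancel norm_triangle_ineq)
      also have "\<dots> \<le> \<epsilon> * \<bar>y - t\<bar> + \<bar>y - t\<bar> * M"
        using r(2)[of y] that v(2) by (intro add_mono) (auto intro: mult_left_mono)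
      finally show ?thesis by (simp add: algebra_simps)
    qed
    have "norm (f y - f x) \<le> (M + \<epsilon>) * (y - x)"
      if "x \<le> t" "t \<le> y" "x \<in> ball t r" "y \<in> ball t r" "a \<le> x" "y \<le> b" for x y
    proof -
      have "norm (f y - f x) \<le> norm (f y - f t) + norm (f x - f t)"
        by (metis norm_triangle_ineq4 diff_diff_eq2 diff_add_cancel)
      also have "\<dots> \<le> (M + \<epsilon>) * \<bar>y - t\<bar> + (M + \<epsilon>) * \<bar>x - t\<bar>"
        using that t by (intro add_mono step) (auto simp: dist_real_def)
      also have "\<dots> = (M + \<epsilon>) * (y - x)" using that by (simp add: algebra_simps)
      finally show ?thesis .
    qed
    then have "Q t (ball t r)" unfolding Q_def using False r(1) by simp
    then show ?thesis ..
  qed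
  then have "\<forall>t\<in>{a..b}. \<exists>\<gamma>. Q t \<gamma>" by blast
  from bchoice[OF this] obtain \<gamma>0 where "\<forall>t\<in>{a..b}. Q t (\<gamma>0 t)" ..
  then have g0: "\<And>t. t \<in> {a..b} \<Longrightarrow> open (\<gamma>0 t) \<and> t \<in> \<gamma>0 t"
    "\<And>t. t \<in> {a..b} \<Longrightarrow> t \<in> bad \<Longrightarrow> \<gamma>0 t \<subseteq> W"
    "\<And>t x y. t \<in> {a..b} \<Longrightarrow> t \<notin> bad \<Longrightarrow> x \<le> t \<Longrightarrow> t \<le> y \<Longrightarrow> x \<in> \<gamma>0 t \<Longrightarrow> y \<in> \<gamma>0 t \<Longrightarrow>
       a \<le> x \<Longrightarrow> y \<le> b \<Longrightarrow> norm (f y - f x) \<le> (M + \<epsilon>) * (y - x)"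
    unfolding Q_def by blast+
  define \<gamma> where "\<gamma> t = (if t \<in> {a..b} then \<gamma>0 t else UNIV)" for t
  have "gauge \<gamma>" unfolding gauge_def \<gamma>_def using g0(1) by auto
  then obtain p where p: "p tagged_division_of {a..b}" "\<gamma> fine p"
    using fine_division_exists_real by blast
  note tag = tagged_division_ofD[OF p(1)]
  have pK: "\<exists>u v. K = {u..v} \<and> u \<le> v \<and> u \<le> t \<and> t \<le> v \<and> a \<le> u \<and> v \<le> b \<and> t \<in> {a..b} \<and> K \<subseteq> \<gamma>0 t"
    if "(t, K) \<in> p" for t K
  proof -
    obtain u v where K: "K = {u..v}" using tag(4)[OF \<open>(t, K) \<in> p\<close>] by (auto simp: cbox_interval)
    have "t \<in> K" "K \<subseteq> {a..b}" using tag(2,3)[OF that] by auto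
    moreover have "K \<subseteq> \<gamma> t" using p(2) that by (auto simp: fine_def)
    ultimately show ?thesis using K by (auto simp: \<gamma>_def intro!: exI[of _ u] exI[of _ v])
  qed
  \<comment> \<open>The end points are read off the piece itself as \<open>Inf\<close> and
    \<open>Sup\<close>, the form in which the telescoping sum over a tagged division is
    available.\<close>
  define lo hi where "lo = (\<lambda>i :: real \<times> real set. Inf (snd i))" and "hi = (\<lambda>i :: real \<times> real set. Sup (snd i))"
  have ends: "snd i = {lo i..hi i} \<and> lo i \<le> hi i \<and> lo i \<le> fst i \<and> fst i \<le> hi i \<and> a \<le> lo i \<and> hi i \<le> b
     \<and> fst i \<in> {a..b} \<and> snd i \<subseteq> \<gamma>0 (fst i)" if "i \<in> p" for i
  proof -
    obtain u v where uv: "snd i = {u..v}" "u \<le> v" "u \<le> fst i" "fst i \<le> v" "a \<le> u" "v \<le> b"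
        "fst i \<in> {a..b}" "snd i \<subseteq> \<gamma>0 (fst i)"
      using pK[of "fst i" "snd i"] \<open>i \<in> p\<close> by (metis prod.collapse)
    then have "lo i = u" "hi i = v" by (simp_all add: lo_def hi_def)
    with uv show ?thesis by simp
  qed
  have len: "measure lborel (snd i) = hi i - lo i" if "i \<in> p" for i
    using ends[OF that] by auto
  have disj: "{lo i<..<hi i} \<inter> {lo j<..<hi j} = {}" if "i \<in> p" "j \<in> p" "i \<noteq> j" for i j
  proof -
    have "interior (snd i) \<inter> interior (snd j) = {}"
      using tag(5)[of "fst i" "snd i" "fst j" "snd j"] that by (metis prod.collapse)
    then show ?thesis using ends[OF that(1)] ends[OF that(2)] by (metis interior_atLeastAtMost_real)
  qed
  define pb where "pb = {i\<in>p. fst i \<in> bad}"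
  have fp: "finite p" "finite pb" using tag(1) by (auto simp: pb_def)
  have "(\<Sum>i\<in>pb. norm (f (hi i) - f (lo i))) < \<epsilon>"
  proof (rule d[rule_format, OF fp(2)])
    show "(\<Sum>i\<in>pb. hi i - lo i) < d"
    proof -
      have "(\<Sum>i\<in>pb. hi i - lo i) = (\<Sum>i\<in>pb. measure lebesgue {lo i<..<hi i})"
        using ends by (intro sum.cong) (auto simp: pb_def)
      also have "\<dots> = measure lebesgue (\<Union>i\<in>pb. {lo i<..<hi i})"
      proof (intro measure_finite_Union[symmetric] fp)
        show "emeasure lebesgue {lo i<..<hi i} \<noteq> \<infinity>" for i
          by (cases "lo i \<le> hi i") auto
      qed (use disj in \<open>auto simp: pb_def disjoint_family_on_def\<close>)
      also have "\<dots> \<le> measure lebesgue W"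
      proof (rule measure_mono_fmeasurable)
        show "(\<Union>i\<in>pb. {lo i<..<hi i}) \<subseteq> W"
        proof (rule UN_least)
          fix i assume "i \<in> pb"
          then have i: "i \<in> p" "fst i \<in> bad" by (auto simp: pb_def)
          have "{lo i<..<hi i} \<subseteq> snd i" using ends[OF i(1)] by auto
          also have "\<dots> \<subseteq> \<gamma>0 (fst i)" using ends[OF i(1)] by blast
          also have "\<dots> \<subseteq> W" using g0(2) i ends[OF i(1)] by blast
          finally show "{lo i<..<hi i} \<subseteq> W" .
        qed
      qed (use Wm fp in auto)
      finally show ?thesis using Wm(2) by linarith
    qed
  next
    fix i assume "i \<in> pb"
    then have "i \<in> p" by (simp add: pb_def)
    from ends[OF this] show "lo i \<le> hi i \<and> {lo i..hi i} \<subseteq> {a..b}" by simp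
  next
    fix i j assume "i \<in> pb" "j \<in> pb" "i \<noteq> j"
    then show "{lo i<..<hi i} \<inter> {lo j<..<hi j} = {}" using disj by (simp add: pb_def)
  qed
  moreover have "(\<Sum>i\<in>p - pb. norm (f (hi i) - f (lo i))) \<le> (\<Sum>i\<in>p - pb. (M + \<epsilon>) * (hi i - lo i))"
  proof (rule sum_mono)
    fix i assume "i \<in> p - pb"
    then have i: "i \<in> p" "fst i \<notin> bad" by (auto simp: pb_def)
    note e = ends[OF i(1)]
    then have "lo i \<in> snd i" "hi i \<in> snd i" by auto
    with e show "norm (f (hi i) - f (lo i)) \<le> (M + \<epsilon>) * (hi i - lo i)"
      by (intro g0(3)[of "fst i"] i) auto
  qed
  moreover have "(\<Sum>i\<in>p - pb. (M + \<epsilon>) * (hi i - lo i)) \<le> (M + \<epsilon>) * (b - a)"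
  proof -
    have "(\<Sum>i\<in>p - pb. hi i - lo i) \<le> (\<Sum>i\<in>p. hi i - lo i)"
      using fp ends by (intro sum_mono2) auto
    also have "\<dots> = (\<Sum>(t, K)\<in>p. measure lborel K)"
      using len by (intro sum.cong) (auto simp: split_beta)
    also have "\<dots> = b - a"
      using additive_content_tagged_division[of p a b] p(1) \<open>a \<le> b\<close> by (simp add: cbox_interval)
    finally show ?thesis
      using \<open>0 \<le> M\<close> \<epsilon>(1) by (simp flip: sum_distrib_left)
  qed
  moreover have "norm (f b - f a) \<le> (\<Sum>i\<in>p. norm (f (hi i) - f (lo i)))"
  proof -
    have "(\<Sum>(t, K)\<in>p. f (Sup K) - f (Inf K)) = f b - f a"
      using additive_tagged_division_1[OF \<open>a \<le> b\<close> p(1)] .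
    then have "f b - f a = (\<Sum>i\<in>p. f (hi i) - f (lo i))" by (simp add: lo_def hi_def split_beta)
    then show ?thesis by (simp add: norm_sum)
  qed
  moreover have "(\<Sum>i\<in>p. norm (f (hi i) - f (lo i)))
      = (\<Sum>i\<in>p - pb. norm (f (hi i) - f (lo i))) + (\<Sum>i\<in>pb. norm (f (hi i) - f (lo i)))"
    using fp by (intro sum.subset_diff) (auto simp: pb_def)
  ultimately have "norm (f b - f a) \<le> (M + \<epsilon>) * (b - a) + \<epsilon>" by linarith
  also have "\<dots> = M * (b - a) + e" using \<epsilon>(2) by (simp add: algebra_simps)
  finally show "norm (f b - f a) \<le> M * (b - a) + e" .
qed

lemma absolutely_continuous_on_subset:
  "absolutely_continuous_on I f \<Longrightarrow> J \<subseteq> I \<Longrightarrow> absolutely_continuous_on J f"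
  unfolding absolutely_continuous_on_def
proof (intro allI impI)
  fix e :: real
  assume ac: "\<forall>e>0. \<exists>d>0. \<forall>(m::nat) a b.
        (\<forall>j<m. a j \<le> b j \<and> {a j..b j} \<subseteq> I) \<and>
        (\<forall>i<m. \<forall>j<m. i \<noteq> j \<longrightarrow> {a i<..<b i} \<inter> {a j<..<b j} = {}) \<and>
        (\<Sum>j<m. b j - a j) < d \<longrightarrow> (\<Sum>j<m. norm (f (b j) - f (a j))) < e"
    and "J \<subseteq> I" "0 < e"
  from ac \<open>0 < e\<close> obtain d where "0 < d" and d: "\<forall>(m::nat) a b.
        (\<forall>j<m. a j \<le> b j \<and> {a j..b j} \<subseteq> I) \<and>
        (\<forall>i<m. \<forall>j<m. i \<noteq> j \<longrightarrow> {a i<..<b i} \<inter> {a j<..<b j} = {}) \<and>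
        (\<Sum>j<m. b j - a j) < d \<longrightarrow> (\<Sum>j<m. norm (f (b j) - f (a j))) < e" by blast
  show "\<exists>d>0. \<forall>(m::nat) a b.
        (\<forall>j<m. a j \<le> b j \<and> {a j..b j} \<subseteq> J) \<and>
        (\<forall>i<m. \<forall>j<m. i \<noteq> j \<longrightarrow> {a i<..<b i} \<inter> {a j<..<b j} = {}) \<and>
        (\<Sum>j<m. b j - a j) < d \<longrightarrow> (\<Sum>j<m. norm (f (b j) - f (a j))) < e"
  proof (rule exI[of _ d], intro conjI allI impI)
    fix m :: nat and a b
    assume h: "(\<forall>j<m. a j \<le> b j \<and> {a j..b j} \<subseteq> J) \<and>
        (\<forall>i<m. \<forall>j<m. i \<noteq> j \<longrightarrow> {a i<..<b i} \<inter> {a j<..<b j} = {}) \<and> (\<Sum>j<m. b j - a j) < d"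
    then have "\<forall>j<m. a j \<le> b j \<and> {a j..b j} \<subseteq> I" using \<open>J \<subseteq> I\<close> by blast
    with h d show "(\<Sum>j<m. norm (f (b j) - f (a j))) < e" by blast
  qed (rule \<open>0 < d\<close>)
qed

section \<open>The Kobayashi distance\<close>

lemma norm_vector_scalar_mult: "norm (c *s (v :: complex ^ 'n)) = cmod c * norm v"
  by (simp add: norm_vec_def L2_set_def norm_mult power_mult_distrib real_sqrt_mult
      flip: sum_distrib_left)

lemma norm_vec_le_card:
  fixes x :: "complex ^ 'n"
  assumes "\<And>i. cmod (x $ i) \<le> B"
  shows "norm x \<le> real CARD('n) * B"
proof -
  have "norm x \<le> (\<Sum>i\<in>UNIV. cmod (x $ i))"
    unfolding norm_vec_def by (rule L2_set_le_sum) simp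
  also have "\<dots> \<le> (\<Sum>i\<in>(UNIV::'n set). B)" by (intro sum_mono assms)
  finally show ?thesis by simp
qed

section \<open>The Poincare distance and Schwarz-Pick estimates for bounded maps\<close>

lemma artanh_ge_self:
  fixes x :: real
  assumes "0 \<le> x" "x < 1"
  shows "x \<le> artanh x"
proof -
  have "artanh 0 - 0 \<le> artanh x - x"
  proof (rule DERIV_nonneg_imp_nondecreasing[OF assms(1)])
    fix y assume "0 \<le> y" "y \<le> x"
    then have y: "\<bar>y\<bar> < 1" using assms by auto
    then have "y\<^sup>2 < 1" by (simp add: abs_square_less_1)
    then have "0 \<le> 1 / (1 - y\<^sup>2) - 1" by (simp add: field_simps)
    moreover have "((\<lambda>y. artanh y - y) has_real_derivative 1 / (1 - y\<^sup>2) - 1) (at y)"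
      using y by (auto intro!: derivative_eq_intros)
    ultimately show "\<exists>D. ((\<lambda>y. artanh y - y) has_real_derivative D) (at y) \<and> 0 \<le> D" by blast
  qed
  then show ?thesis by simp
qed

lemma norm_pseudo_hyperbolic_less_1:
  assumes "cmod a < 1" "cmod b < 1"
  shows "cmod ((a - b) / (1 - cnj a * b)) < 1"
  using Moebius_function_norm_lt_1[OF assms, of 0]
  by (simp add: Moebius_function_def norm_divide norm_minus_commute)

lemma pseudo_hyperbolic_le_poincare_dist:
  assumes "cmod a < 1" "cmod b < 1"
  shows "cmod ((a - b) / (1 - cnj a * b)) \<le> poincare_dist a b"
  unfolding poincare_dist_def
  by (rule artanh_ge_self) (use norm_pseudo_hyperbolic_less_1[OF assms] in auto)

lemma poincare_dist_nonneg: "cmod a < 1 \<Longrightarrow> cmod b < 1 \<Longrightarrow> 0 \<le> poincare_dist a b"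
  using pseudo_hyperbolic_le_poincare_dist[of a b] norm_ge_zero order_trans by blast

lemma poincare_dist_commute: "poincare_dist a b = poincare_dist b a"
proof -
  have "cmod (1 - cnj a * b) = cmod (cnj (1 - cnj a * b))" by (rule complex_mod_cnj[symmetric])
  also have "cnj (1 - cnj a * b) = 1 - cnj b * a" by (simp add: mult.commute)
  finally show ?thesis
    by (simp add: poincare_dist_def norm_divide norm_minus_commute)
qed

text \<open>Precomposition with the Moebius map that sends 0 to \<open>c\<close>, followed by
  subtraction of \<open>f c\<close>, gives a map that vanishes at 0 and has values of modulus below
  \<open>2 * R\<close>; the doubling comes from this recentring. The Schwarz lemma applies to it
  after division by \<open>2 * R\<close>. For \<open>c = a\<close> the point \<open>z\<close> over
  \<open>b\<close> has modulus equal to the pseudo-hyperbolic distance of \<open>a\<close> and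
  \<open>b\<close>, which \<open>artanh\<close> only enlarges; \<open>c = 0\<close> gives the
  derivative.\<close>

lemma schwarz_pick_bounded:
  assumes holf: "f holomorphic_on ball 0 1" and bd: "\<And>z. cmod z < 1 \<Longrightarrow> cmod (f z) < R"
    and a: "cmod a < 1" and b: "cmod b < 1"
  shows "cmod (f a - f b) \<le> 2 * R * poincare_dist a b" and "cmod (deriv f 0) \<le> 2 * R"
proof -
  have "0 < R" using bd[of 0] norm_ge_zero[of "f 0"] by (simp del: norm_ge_zero)
  have key: "cmod (f (Moebius_function 0 (-c) z) - f c) \<le> 2 * R * cmod z"
      "cmod (deriv (\<lambda>z. f (Moebius_function 0 (-c) z)) 0) \<le> 2 * R"
    if c: "cmod c < 1" and z: "cmod z < 1" for c z
  proof -
    define h where "h = (\<lambda>z. (f (Moebius_function 0 (-c) z) - f c) / (2 * R))"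
    have M: "Moebius_function 0 (-c) holomorphic_on ball 0 1"
      using c by (intro Moebius_function_holomorphic) simp
    have Mb: "cmod (Moebius_function 0 (-c) w) < 1" if "cmod w < 1" for w
      using c that by (intro Moebius_function_norm_lt_1) auto
    have holc: "(\<lambda>z. f (Moebius_function 0 (-c) z)) holomorphic_on ball 0 1"
      using holomorphic_on_compose_gen[OF M holf] Mb by (auto simp: o_def image_subset_iff)
    then have holh: "h holomorphic_on ball 0 1" unfolding h_def
      using \<open>0 < R\<close> by (intro holomorphic_intros) auto
    have h0: "h 0 = 0" by (simp add: h_def Moebius_function_of_zero)
    have hb: "cmod (h w) < 1" if "cmod w < 1" for w
    proof -
      have "cmod (f (Moebius_function 0 (-c) w) - f c) < R + R"
        using norm_triangle_ineq4[of "f (Moebius_function 0 (-c) w)" "f c"] bd[OF Mb[OF that]] bd[OF c]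
        by linarith
      then show ?thesis using \<open>0 < R\<close> by (simp add: h_def norm_divide norm_mult)
    qed
    show "cmod (f (Moebius_function 0 (-c) z) - f c) \<le> 2 * R * cmod z"
      using Schwarz_Lemma(1)[OF holh h0 hb z] \<open>0 < R\<close>
      by (simp add: h_def norm_divide norm_mult field_simps)
    have "deriv h 0 = deriv (\<lambda>z. f (Moebius_function 0 (-c) z)) 0 / (2 * R)"
    proof -
      have "(\<lambda>z. f (Moebius_function 0 (-c) z)) field_differentiable at 0"
        using holc by (intro holomorphic_on_imp_differentiable_at[of _ "ball 0 1"]) auto
      then have "(h has_field_derivative deriv (\<lambda>z. f (Moebius_function 0 (-c) z)) 0 / (2 * R)) (at 0)"
        unfolding h_def using \<open>0 < R\<close>
        by (auto intro!: derivative_eq_intros simp: DERIV_deriv_iff_field_differentiable)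
      then show ?thesis by (rule DERIV_imp_deriv)
    qed
    then show "cmod (deriv (\<lambda>z. f (Moebius_function 0 (-c) z)) 0) \<le> 2 * R"
      using Schwarz_Lemma(2)[OF holh h0 hb z] \<open>0 < R\<close>
      by (simp add: norm_divide norm_mult divide_le_eq)
  qed
  have "Moebius_function 0 (-0) = (\<lambda>z. z)" by (auto simp: Moebius_function_def)
  then show "cmod (deriv f 0) \<le> 2 * R" using key(2)[of 0 0] by simp
  define z where "z = Moebius_function 0 a b"
  have z: "cmod z < 1" unfolding z_def using a b by (rule Moebius_function_norm_lt_1)
  have fz: "Moebius_function 0 (-a) z = b"
    unfolding z_def using a b by (intro Moebius_function_compose) auto
  have "cmod z = cmod ((a - b) / (1 - cnj a * b))"
    by (simp add: z_def Moebius_function_def norm_divide norm_minus_commute)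
  then have "cmod z \<le> poincare_dist a b" using pseudo_hyperbolic_le_poincare_dist[OF a b] by simp
  then have "2 * R * cmod z \<le> 2 * R * poincare_dist a b" using \<open>0 < R\<close> by simp
  with key(1)[OF a z] fz show "cmod (f a - f b) \<le> 2 * R * poincare_dist a b"
    by (simp add: norm_minus_commute)
qed

text \<open>Schwarz-Pick in each coordinate. The first bound makes the Kobayashi distance dominate
  the Euclidean one, the second makes the infinitesimal metric dominate the Euclidean norm.\<close>

lemma bounded_domain_disc_bounds:
  fixes \<Omega> :: "(complex ^ 'n) set"
  assumes "bounded \<Omega>"
  obtains C where "0 < C"
    "\<And>f a b. holomorphic_disc \<Omega> f \<Longrightarrow> cmod a < 1 \<Longrightarrow> cmod b < 1 \<Longrightarrow> norm (f a - f b) \<le> C * poincare_dist a b"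
    "\<And>f. holomorphic_disc \<Omega> f \<Longrightarrow> norm (\<chi> i. deriv (\<lambda>\<omega>. f \<omega> $ i) 0) \<le> C"
proof -
  obtain R where R: "0 < R" "\<And>z. z \<in> \<Omega> \<Longrightarrow> norm z < R"
    using bounded_pos_less[of \<Omega>] assms by blast
  have fR: "cmod (f z $ i) < R" if "holomorphic_disc \<Omega> f" "cmod z < 1"
    for f :: "complex \<Rightarrow> complex ^ 'n" and z i
    using R(2)[of "f z"] Finite_Cartesian_Product.norm_nth_le[of "f z" i] that
    by (force simp: holomorphic_disc_def)
  show ?thesis
  proof (rule that[of "real CARD('n) * (2 * R)"])
    show "norm (f a - f b) \<le> real CARD('n) * (2 * R) * poincare_dist a b"
      if f: "holomorphic_disc \<Omega> f" "cmod a < 1" "cmod b < 1" for f a b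
    proof -
      have "cmod ((f a - f b) $ i) \<le> 2 * R * poincare_dist a b" for i
        using schwarz_pick_bounded(1)[of "\<lambda>\<zeta>. f \<zeta> $ i" R a b] f fR
        by (auto simp: holomorphic_disc_def)
      from norm_vec_le_card[OF this] show ?thesis by (simp add: mult.assoc)
    qed
    show "norm (\<chi> i. deriv (\<lambda>\<omega>. f \<omega> $ i) 0) \<le> real CARD('n) * (2 * R)"
      if f: "holomorphic_disc \<Omega> f" for f
      using schwarz_pick_bounded(2)[of "\<lambda>\<zeta>. f \<zeta> $ _" R 0 0] f fR
      by (intro norm_vec_le_card) (auto simp: holomorphic_disc_def)
  qed (use R in auto)
qed

section \<open>Chains of holomorphic discs and the distance they define\<close>

inductive disc_chain :: "(complex ^ 'n) set \<Rightarrow> complex ^ 'n \<Rightarrow> complex ^ 'n \<Rightarrow> real \<Rightarrow> bool"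
  for \<Omega> where
  disc_chain_refl: "disc_chain \<Omega> z z 0"
| disc_chain_step: "disc_chain \<Omega> z (f a) x \<Longrightarrow> holomorphic_disc \<Omega> f \<Longrightarrow> cmod a < 1 \<Longrightarrow> cmod b < 1 \<Longrightarrow>
    disc_chain \<Omega> z (f b) (x + poincare_dist a b)"

text \<open>Trades the indexed sequences of the definition for an inductive predicate, so that
  chains can be reversed, concatenated and translated link by link. The case \<open>m = 0\<close>
  corresponds to \<open>disc_chain_refl\<close>, which holds for every point of the space.\<close>

lemma disc_chain_lengths_eq: "disc_chain_lengths \<Omega> z w = {x. disc_chain \<Omega> z w x}"
proof (intro set_eqI iffI)
  fix x assume "x \<in> disc_chain_lengths \<Omega> z w"
  then obtain m a b p f where x: "x = (\<Sum>j<m::nat. poincare_dist (a j) (b j))" "p 0 = z" "p m = w"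
    and f: "\<And>j. j < m \<Longrightarrow> holomorphic_disc \<Omega> (f j) \<and> a j \<in> ball 0 1 \<and> b j \<in> ball 0 1 \<and>
        f j (a j) = p j \<and> f j (b j) = p (Suc j)"
    unfolding disc_chain_lengths_def by blast
  have "disc_chain \<Omega> z (p k) (\<Sum>j<k. poincare_dist (a j) (b j))" if "k \<le> m" for k
    using that
  proof (induction k)
    case 0 then show ?case using x disc_chain_refl by simp
  next
    case (Suc k)
    with f[of k] disc_chain_step[of \<Omega> z "f k" "a k" "\<Sum>j<k. poincare_dist (a j) (b j)" "b k"]
    show ?case by simp
  qed
  from this[of m] x show "x \<in> {x. disc_chain \<Omega> z w x}" by simp
next
  fix x assume "x \<in> {x. disc_chain \<Omega> z w x}"
  then have "disc_chain \<Omega> z w x" by simp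
  then show "x \<in> disc_chain_lengths \<Omega> z w"
  proof induction
    case (disc_chain_refl z)
    show ?case unfolding disc_chain_lengths_def by (intro CollectI exI[of _ "0::nat"] exI[of _ "\<lambda>_. z"] exI) auto
  next
    case (disc_chain_step z g a' x b')
    then obtain m a b p f where x: "x = (\<Sum>j<m::nat. poincare_dist (a j) (b j))" "p 0 = z" "p m = g a'"
      and f: "\<forall>j<m. holomorphic_disc \<Omega> (f j) \<and> a j \<in> ball 0 1 \<and> b j \<in> ball 0 1 \<and>
          f j (a j) = p j \<and> f j (b j) = p (Suc j)"
      unfolding disc_chain_lengths_def by blast
    have "x + poincare_dist a' b' = (\<Sum>j<Suc m. poincare_dist ((a(m := a')) j) ((b(m := b')) j))"
      using x by simp
    moreover have "(p(Suc m := g b')) 0 = z" "(p(Suc m := g b')) (Suc m) = g b'" using x by auto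
    moreover have "\<forall>j<Suc m. holomorphic_disc \<Omega> ((f(m := g)) j) \<and> (a(m := a')) j \<in> ball 0 1 \<and>
        (b(m := b')) j \<in> ball 0 1 \<and> (f(m := g)) j ((a(m := a')) j) = (p(Suc m := g b')) j \<and>
        (f(m := g)) j ((b(m := b')) j) = (p(Suc m := g b')) (Suc j)"
      using f x disc_chain_step by (auto simp: less_Suc_eq)
    ultimately show ?case unfolding disc_chain_lengths_def by blast
  qed
qed

lemma disc_chain_mono: "disc_chain \<Omega> z w x \<Longrightarrow> \<Omega> \<subseteq> \<Omega>' \<Longrightarrow> disc_chain \<Omega>' z w x"
  by (induction rule: disc_chain.induct)
    (auto intro!: disc_chain.intros simp: holomorphic_disc_def)

lemma disc_chain_nonneg: "disc_chain \<Omega> z w x \<Longrightarrow> 0 \<le> x"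
  by (induction rule: disc_chain.induct) (auto intro!: add_nonneg_nonneg poincare_dist_nonneg)

lemma disc_chain_trans: "disc_chain \<Omega> z w x \<Longrightarrow> disc_chain \<Omega> y z u \<Longrightarrow> disc_chain \<Omega> y w (u + x)"
proof (induction arbitrary: rule: disc_chain.induct)
  case (disc_chain_step z f a x b)
  then show ?case using disc_chain.disc_chain_step[of \<Omega> y f a "u + x" b] by (simp add: add.assoc)
qed simp

lemma disc_chain_single:
  "holomorphic_disc \<Omega> f \<Longrightarrow> cmod a < 1 \<Longrightarrow> cmod b < 1 \<Longrightarrow> disc_chain \<Omega> (f a) (f b) (poincare_dist a b)"
  using disc_chain_step[OF disc_chain_refl, of \<Omega> f a b] by simp

lemma disc_chain_sym: "disc_chain \<Omega> z w x \<Longrightarrow> disc_chain \<Omega> w z x"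
proof (induction rule: disc_chain.induct)
  case (disc_chain_step z f a x b)
  have "disc_chain \<Omega> (f b) (f a) (poincare_dist a b)"
    using disc_chain_single[OF disc_chain_step(2,4,3)] by (simp add: poincare_dist_commute)
  from disc_chain_trans[OF disc_chain_step.IH this] show ?case by (simp add: add.commute)
qed (rule disc_chain_refl)

lemma disc_chain_dist_le:
  assumes "\<And>f a b. holomorphic_disc \<Omega> f \<Longrightarrow> cmod a < 1 \<Longrightarrow> cmod b < 1 \<Longrightarrow>
             norm (f a - f b) \<le> C * poincare_dist a b"
  shows "disc_chain \<Omega> z w x \<Longrightarrow> dist z w \<le> C * x"
proof (induction rule: disc_chain.induct)
  case (disc_chain_step z f a x b)
  have "dist z (f b) \<le> dist z (f a) + norm (f a - f b)"
    using dist_triangle[of z "f b" "f a"] by (simp add: dist_norm)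
  with assms[OF disc_chain_step(2-4)] disc_chain_step.IH show ?case
    by (simp add: distrib_left)
qed simp

lemma holomorphic_disc_affine:
  fixes z v :: "complex ^ 'n"
  assumes "ball z r \<subseteq> \<Omega>" "0 < r" "norm v \<le> r"
  shows "holomorphic_disc \<Omega> (\<lambda>\<zeta>. z + \<zeta> *s v)"
  unfolding holomorphic_disc_def
proof
  show "\<forall>i. (\<lambda>\<zeta>. (z + \<zeta> *s v) $ i) holomorphic_on ball 0 1"
    by (auto intro!: holomorphic_intros)
  show "(\<lambda>\<zeta>. z + \<zeta> *s v) ` ball 0 1 \<subseteq> \<Omega>"
  proof clarify
    fix \<zeta> :: complex assume "\<zeta> \<in> ball 0 1"
    show "z + \<zeta> *s v \<in> \<Omega>"
    proof (cases "v = 0")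
      case True
      with assms show ?thesis by auto
    next
      case False
      then have "cmod \<zeta> * norm v < norm v" using \<open>\<zeta> \<in> ball 0 1\<close> by simp
      then have "norm (\<zeta> *s v) < r" using assms(3) by (simp add: norm_vector_scalar_mult)
      then show ?thesis using assms(1) by (intro subsetD[OF assms(1)]) (simp add: dist_norm)
    qed
  qed
qed

text \<open>One affine disc suffices: it has centre \<open>z\<close>, points in the direction of
  \<open>w\<close> and has a derivative of norm \<open>r\<close>. Then \<open>w\<close> is the image
  of \<open>dist z w / r\<close>, whose Poincare distance from 0 is the stated length.\<close>

lemma disc_chain_ball:
  fixes z w :: "complex ^ 'n"
  assumes "ball z r \<subseteq> \<Omega>" "w \<in> ball z r"
  shows "disc_chain \<Omega> z w (artanh (dist z w / r))"
proof (cases "w = z")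
  case True
  then show ?thesis by (simp add: disc_chain_refl)
next
  case False
  have "dist z w < r" using assms(2) by simp
  then have r: "0 < r" using zero_le_dist[of z w] by linarith
  define d where "d = dist z w"
  have d: "0 < d" "d < r" using False \<open>dist z w < r\<close> by (auto simp: d_def)
  define v where "v = complex_of_real (r / d) *s (w - z)"
  have "norm v = r / d * norm (w - z)"
    using d r by (simp only: v_def norm_vector_scalar_mult norm_of_real) simp
  then have nv: "norm v = r" using d by (simp add: d_def dist_norm norm_minus_commute)
  have hol: "holomorphic_disc \<Omega> (\<lambda>\<zeta>. z + \<zeta> *s v)"
    using assms(1) r nv by (intro holomorphic_disc_affine) auto
  have w: "z + complex_of_real (d / r) *s v = w"
  proof -
    have "complex_of_real (d / r) * complex_of_real (r / d) = 1"
      using d r by (simp flip: of_real_mult)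
    then show ?thesis by (simp add: v_def vector_smult_assoc)
  qed
  have "cmod (complex_of_real (d / r)) < 1" using d r by (simp add: norm_divide)
  from disc_chain_single[OF hol _ this, of 0] w have
    "disc_chain \<Omega> z w (poincare_dist 0 (complex_of_real (d / r)))" by simp
  also have "poincare_dist 0 (complex_of_real (d / r)) = artanh (d / r)"
    using d r by (simp add: poincare_dist_def norm_divide)
  finally show ?thesis by (simp add: d_def)
qed

text \<open>Being joined by a chain is an equivalence relation with open classes, so a connected set
  has a single class. Without a chain the infimum in \<open>kobayashi_dist\<close> would be that of
  an empty set of reals, an unspecified value.\<close>

lemma disc_chain_exists:
  fixes z w :: "complex ^ 'n"
  assumes "is_domain \<Omega>" "z \<in> \<Omega>" "w \<in> \<Omega>"
  shows "\<exists>x. disc_chain \<Omega> z w x"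
proof -
  have "connected \<Omega>" "open \<Omega>" using assms(1) by (auto simp: is_domain_def)
  show ?thesis
  proof (rule connected_equivalence_relation[OF \<open>connected \<Omega>\<close> assms(2,3)])
    show "\<exists>x. disc_chain \<Omega> b a x" if "\<exists>x. disc_chain \<Omega> a b x" for a b
      using that disc_chain_sym by blast
    show "\<exists>x. disc_chain \<Omega> a c x" if "\<exists>x. disc_chain \<Omega> a b x" "\<exists>x. disc_chain \<Omega> b c x" for a b c
      using that disc_chain_trans by blast
    show "\<exists>T. openin (top_of_set \<Omega>) T \<and> a \<in> T \<and> (\<forall>b\<in>T. \<exists>x. disc_chain \<Omega> a b x)"
      if "a \<in> \<Omega>" for a
    proof -
      obtain r where "0 < r" "ball a r \<subseteq> \<Omega>"
        using \<open>open \<Omega>\<close> \<open>a \<in> \<Omega>\<close> by (auto simp: open_contains_ball)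
      then have "openin (top_of_set \<Omega>) (ball a r)" "a \<in> ball a r"
        by (auto simp: openin_open_eq \<open>open \<Omega>\<close>)
      then show ?thesis using disc_chain_ball[OF \<open>ball a r \<subseteq> \<Omega>\<close>] by blast
    qed
  qed
qed

lemma bdd_below_disc_chain: "bdd_below {x. disc_chain \<Omega> z w x}"
  by (rule bdd_belowI[of _ 0]) (auto intro: disc_chain_nonneg)

lemma kobayashi_dist_le:
  "z \<in> \<Omega> \<Longrightarrow> w \<in> \<Omega> \<Longrightarrow> disc_chain \<Omega> z w x \<Longrightarrow> kobayashi_dist \<Omega> z w \<le> x"
  unfolding kobayashi_dist_def disc_chain_lengths_eq
  by (simp add: cInf_lower bdd_below_disc_chain)

lemma kobayashi_dist_ball:
  fixes z w :: "complex ^ 'n"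
  assumes "ball z r \<subseteq> \<Omega>" "w \<in> ball z r"
  shows "kobayashi_dist \<Omega> z w \<le> artanh (dist z w / r)"
proof -
  have "dist z w < r" using assms(2) by simp
  then have "0 < r" using zero_le_dist[of z w] by linarith
  then show ?thesis using assms by (intro kobayashi_dist_le disc_chain_ball) auto
qed

lemma kobayashi_dist_chain:
  assumes "is_domain \<Omega>" "z \<in> \<Omega>" "w \<in> \<Omega>" "0 < e"
  obtains x where "disc_chain \<Omega> z w x" "x < kobayashi_dist \<Omega> z w + e"
proof -
  have "{x. disc_chain \<Omega> z w x} \<noteq> {}" using disc_chain_exists[OF assms(1-3)] by blast
  moreover have "Inf {x. disc_chain \<Omega> z w x} < kobayashi_dist \<Omega> z w + e"
    using assms by (simp add: kobayashi_dist_def disc_chain_lengths_eq)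
  ultimately obtain x where "x \<in> {x. disc_chain \<Omega> z w x}" "x < kobayashi_dist \<Omega> z w + e"
    by (rule cInf_lessD[THEN bexE])
  then show ?thesis using that by simp
qed

lemma kobayashi_dist_refl: "kobayashi_dist \<Omega> z z \<le> 0"
proof (cases "z \<in> \<Omega>")
  case True
  then show ?thesis by (intro kobayashi_dist_le disc_chain_refl)
qed (simp add: kobayashi_dist_def)

lemma kobayashi_dist_commute: "kobayashi_dist \<Omega> z w = kobayashi_dist \<Omega> w z"
proof -
  have "{x. disc_chain \<Omega> z w x} = {x. disc_chain \<Omega> w z x}" using disc_chain_sym by blast
  then show ?thesis by (auto simp: kobayashi_dist_def disc_chain_lengths_eq)
qed

lemma kobayashi_dist_triangle:
  assumes "is_domain \<Omega>" "x \<in> \<Omega>" "y \<in> \<Omega>" "z \<in> \<Omega>"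
  shows "kobayashi_dist \<Omega> x z \<le> kobayashi_dist \<Omega> x y + kobayashi_dist \<Omega> y z"
proof (rule field_le_epsilon)
  fix e :: real assume "0 < e"
  then have "0 < e / 2" by simp
  obtain u where u: "disc_chain \<Omega> x y u" "u < kobayashi_dist \<Omega> x y + e / 2"
    using kobayashi_dist_chain[OF assms(1-3) \<open>0 < e / 2\<close>] .
  obtain v where v: "disc_chain \<Omega> y z v" "v < kobayashi_dist \<Omega> y z + e / 2"
    using kobayashi_dist_chain[OF assms(1,3,4) \<open>0 < e / 2\<close>] .
  show "kobayashi_dist \<Omega> x z \<le> kobayashi_dist \<Omega> x y + kobayashi_dist \<Omega> y z + e"
    using kobayashi_dist_le[OF assms(2,4) disc_chain_trans[OF v(1) u(1)]] u(2) v(2) by linarith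
qed

lemma kobayashi_dist_ge:
  assumes "is_domain \<Omega>" "z \<in> \<Omega>" "w \<in> \<Omega>"
    and "\<And>x. disc_chain \<Omega> z w x \<Longrightarrow> y \<le> x"
  shows "y \<le> kobayashi_dist \<Omega> z w"
  using assms disc_chain_exists[OF assms(1-3)]
  by (auto simp: kobayashi_dist_def disc_chain_lengths_eq intro!: cInf_greatest)

lemma kobayashi_dist_antimono:
  assumes "is_domain \<Omega>" "\<Omega> \<subseteq> D" "z \<in> \<Omega>" "w \<in> \<Omega>"
  shows "kobayashi_dist D z w \<le> kobayashi_dist \<Omega> z w"
proof (rule kobayashi_dist_ge[OF assms(1,3,4)])
  fix x assume "disc_chain \<Omega> z w x"
  then have "disc_chain D z w x" using assms(2) by (rule disc_chain_mono)
  then show "kobayashi_dist D z w \<le> x" using assms by (intro kobayashi_dist_le) auto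
qed

section \<open>Comparison of the Kobayashi and Euclidean distances on bounded domains\<close>

lemma dist_le_kobayashi_dist:
  fixes \<Omega> :: "(complex ^ 'n) set"
  assumes "is_domain \<Omega>" "bounded \<Omega>"
  obtains C where "0 < C" "\<And>z w. z \<in> \<Omega> \<Longrightarrow> w \<in> \<Omega> \<Longrightarrow> dist z w \<le> C * kobayashi_dist \<Omega> z w"
proof -
  obtain C where C: "0 < C"
    "\<And>f a b. holomorphic_disc \<Omega> f \<Longrightarrow> cmod a < 1 \<Longrightarrow> cmod b < 1 \<Longrightarrow> norm (f a - f b) \<le> C * poincare_dist a b"
    using bounded_domain_disc_bounds[OF assms(2)] by metis
  show ?thesis
  proof (rule that[OF C(1)])
    fix z w assume zw: "z \<in> \<Omega>" "w \<in> \<Omega>"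
    have "dist z w \<le> C * x" if "disc_chain \<Omega> z w x" for x
      using that by (rule disc_chain_dist_le[rotated]) (rule C(2))
    then have "dist z w / C \<le> kobayashi_dist \<Omega> z w"
      using \<open>0 < C\<close> by (intro kobayashi_dist_ge[OF assms(1) zw]) (simp add: divide_le_eq mult.commute)
    then show "dist z w \<le> C * kobayashi_dist \<Omega> z w" using \<open>0 < C\<close> by (simp add: divide_le_eq mult.commute)
  qed
qed

lemma Metric_space_kobayashi_dist:
  fixes \<Omega> :: "(complex ^ 'n) set"
  assumes "is_domain \<Omega>" "bounded \<Omega>"
  shows "Metric_space \<Omega> (kobayashi_dist \<Omega>)"
proof -
  obtain C where C: "0 < C" "\<And>z w. z \<in> \<Omega> \<Longrightarrow> w \<in> \<Omega> \<Longrightarrow> dist z w \<le> C * kobayashi_dist \<Omega> z w"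
    using dist_le_kobayashi_dist[OF assms] by metis
  have nonneg: "0 \<le> kobayashi_dist \<Omega> z w" for z w
  proof (cases "z \<in> \<Omega> \<and> w \<in> \<Omega>")
    case True
    then show ?thesis
      by (intro kobayashi_dist_ge[OF assms(1)]) (blast intro: disc_chain_nonneg)+
  qed (auto simp: kobayashi_dist_def)
  show ?thesis
  proof
    show "kobayashi_dist \<Omega> x y = 0 \<longleftrightarrow> x = y" if "x \<in> \<Omega>" "y \<in> \<Omega>" for x y
      using C(2)[OF that] kobayashi_dist_refl[of \<Omega> x] nonneg[of x x] by (auto intro: antisym)
  qed (rule nonneg kobayashi_dist_commute kobayashi_dist_triangle[OF assms(1)]; assumption)+
qed

text \<open>Continuity of the distance for the Euclidean topology, from the affine discs in a ball
  around \<open>z\<close>. It absorbs the displacement of end points under small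
  translations.\<close>

lemma kobayashi_dist_small:
  fixes z :: "complex ^ 'n"
  assumes "open \<Omega>" "z \<in> \<Omega>" "0 < e"
  obtains d where "0 < d" "ball z d \<subseteq> \<Omega>" "\<And>w. dist z w < d \<Longrightarrow> kobayashi_dist \<Omega> z w < e"
proof -
  obtain r where r: "0 < r" "ball z r \<subseteq> \<Omega>" using assms by (auto simp: open_contains_ball)
  have "((\<lambda>x. artanh (x / r)) \<longlongrightarrow> artanh (0 / r)) (at_right 0)"
    using r by (intro tendsto_intros) auto
  then have "eventually (\<lambda>x. artanh (x / r) < e) (at_right 0)"
    using \<open>0 < e\<close> by (intro order_tendstoD) auto
  then obtain b where b: "0 < b" "\<And>x. 0 < x \<Longrightarrow> x < b \<Longrightarrow> artanh (x / r) < e"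
    by (auto simp: eventually_at_right_field)
  show ?thesis
  proof (rule that[of "min b r"])
    show "kobayashi_dist \<Omega> z w < e" if w: "dist z w < min b r" for w
    \<comment> \<open>The right-hand limit controls positive arguments only, so \<open>w = z\<close>
      is treated apart.\<close>
    proof (cases "w = z")
      case True
      then show ?thesis using kobayashi_dist_refl[of \<Omega> z] \<open>0 < e\<close> by simp
    next
      case False
      have "kobayashi_dist \<Omega> z w \<le> artanh (dist z w / r)"
        using w by (intro kobayashi_dist_ball r) auto
      also have "\<dots> < e" using w False by (intro b) auto
      finally show ?thesis .
    qed
  qed (use b r in auto)
qed

text \<open>The distance from a base point of \<open>K\<close> is continuous on \<open>K\<close>,
  hence bounded. Together with the lower bound in the definition of almost-geodesics this limits the
  parameter length of those whose ends lie in \<open>K\<close>.\<close>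

lemma kobayashi_dist_bounded_on_compact:
  fixes \<Omega> :: "(complex ^ 'n) set"
  assumes "is_domain \<Omega>" "bounded \<Omega>" "compact K" "K \<subseteq> \<Omega>"
  obtains B where "\<And>z w. z \<in> K \<Longrightarrow> w \<in> K \<Longrightarrow> kobayashi_dist \<Omega> z w \<le> B"
proof (cases "K = {}")
  case False
  then obtain x where x: "x \<in> K" by blast
  interpret M: Metric_space \<Omega> "kobayashi_dist \<Omega>" using Metric_space_kobayashi_dist[OF assms(1,2)] .
  have "open \<Omega>" using assms(1) by (simp add: is_domain_def)
  have "continuous_on K (kobayashi_dist \<Omega> x)"
    unfolding continuous_on_iff
  proof (intro ballI allI impI)
    fix z and e :: real assume z: "z \<in> K" and "0 < e"
    then have "z \<in> \<Omega>" using assms(4) by blast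
    obtain d where d: "0 < d" "\<And>w. dist z w < d \<Longrightarrow> kobayashi_dist \<Omega> z w < e"
      using kobayashi_dist_small[OF \<open>open \<Omega>\<close> \<open>z \<in> \<Omega>\<close> \<open>0 < e\<close>] by metis
    have "dist (kobayashi_dist \<Omega> x w) (kobayashi_dist \<Omega> x z) < e" if "w \<in> K" "dist w z < d" for w
    proof -
      have "kobayashi_dist \<Omega> z w < e" using that by (intro d) (simp add: dist_commute)
      moreover have "x \<in> \<Omega>" "z \<in> \<Omega>" "w \<in> \<Omega>" using assms(4) x z that(1) by blast+
      ultimately show ?thesis
        using M.triangle[of x z w] M.triangle[of x w z] M.commute[of z w]
        by (simp add: dist_real_def abs_less_iff)
    qed
    with d(1) show "\<exists>d>0. \<forall>w\<in>K. dist w z < d \<longrightarrow>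
        dist (kobayashi_dist \<Omega> x w) (kobayashi_dist \<Omega> x z) < e" by blast
  qed
  then have "compact (kobayashi_dist \<Omega> x ` K)" using assms(3) by (rule compact_continuous_image)
  then obtain B where "\<forall>y\<in>kobayashi_dist \<Omega> x ` K. norm y \<le> B"
    using compact_imp_bounded bounded_iff by blast
  then have B: "kobayashi_dist \<Omega> x z \<le> B" if "z \<in> K" for z
    using that by (simp add: abs_le_iff)
  show ?thesis
  proof (rule that[of "B + B"])
    fix z w assume zw: "z \<in> K" "w \<in> K"
    then have "x \<in> \<Omega>" "z \<in> \<Omega>" "w \<in> \<Omega>" using assms(4) x by blast+
    then show "kobayashi_dist \<Omega> z w \<le> B + B"
      using M.triangle[of z x w] M.commute[of x z] B[OF zw(1)] B[OF zw(2)] by simp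
  qed
next
  case True
  then show ?thesis using that by simp
qed

section \<open>The infinitesimal Kobayashi metric\<close>

lemma kobayashi_metric_set_nonempty:
  fixes z v :: "complex ^ 'n"
  assumes "open \<Omega>" "z \<in> \<Omega>"
  shows "{cmod \<zeta> | \<zeta>. \<exists>f. holomorphic_disc \<Omega> f \<and> f 0 = z \<and>
            \<zeta> *s (\<chi> i. deriv (\<lambda>\<omega>. f \<omega> $ i) 0) = v} \<noteq> {}"
proof -
  obtain r where r: "0 < r" "ball z r \<subseteq> \<Omega>" using assms by (auto simp: open_contains_ball)
  \<comment> \<open>The competitor is the affine disc with derivative \<open>s\<close> times
    \<open>v\<close> and multiplier \<open>1 / s\<close>. Adding 1 in the denominator keeps
    \<open>s\<close> defined for \<open>v = 0\<close>.\<close>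
  define s where "s = r / (norm v + 1)"
  have nv: "0 < norm v + 1" using norm_ge_zero[of v] by linarith
  have s: "0 < s" using r nv by (simp add: s_def)
  define u where "u = complex_of_real s *s v"
  define f where "f = (\<lambda>\<zeta>. z + \<zeta> *s u)"
  have "norm u = s * norm v" using s by (simp add: u_def norm_vector_scalar_mult)
  also have "\<dots> \<le> s * (norm v + 1)" using s by (intro mult_left_mono) auto
  also have "\<dots> = r" using nv by (simp add: s_def)
  finally have "norm u \<le> r" .
  then have "holomorphic_disc \<Omega> f" unfolding f_def using r by (intro holomorphic_disc_affine) auto
  moreover have "f 0 = z" by (simp add: f_def)
  moreover have "(\<chi> i. deriv (\<lambda>\<omega>. f \<omega> $ i) 0) = u"
  proof (rule iffD2[OF vec_eq_iff], rule allI)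
    fix i
    have "((\<lambda>\<omega>. f \<omega> $ i) has_field_derivative u $ i) (at 0)"
      unfolding f_def by (auto intro!: derivative_eq_intros)
    then show "(\<chi> i. deriv (\<lambda>\<omega>. f \<omega> $ i) 0) $ i = u $ i" by (simp add: DERIV_imp_deriv)
  qed
  moreover have "complex_of_real (1 / s) *s u = v"
  proof -
    have "complex_of_real (1 / s) * complex_of_real s = 1" using s by (simp flip: of_real_mult)
    then show ?thesis by (simp add: u_def vector_smult_assoc)
  qed
  ultimately show ?thesis by blast
qed

lemma kobayashi_metric_antimono:
  fixes z v :: "complex ^ 'n"
  assumes "open \<Omega>" "\<Omega> \<subseteq> D" "z \<in> \<Omega>"
  shows "kobayashi_metric D z v \<le> kobayashi_metric \<Omega> z v"
  unfolding kobayashi_metric_def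
proof (rule cInf_superset_mono)
  show "{cmod \<zeta> | \<zeta>. \<exists>f. holomorphic_disc \<Omega> f \<and> f 0 = z \<and>
            \<zeta> *s (\<chi> i. deriv (\<lambda>\<omega>. f \<omega> $ i) 0) = v}
      \<subseteq> {cmod \<zeta> | \<zeta>. \<exists>f. holomorphic_disc D f \<and> f 0 = z \<and>
            \<zeta> *s (\<chi> i. deriv (\<lambda>\<omega>. f \<omega> $ i) 0) = v}"
    using assms(2) unfolding holomorphic_disc_def by blast
  show "bdd_below {cmod \<zeta> | \<zeta>. \<exists>f. holomorphic_disc D f \<and> f 0 = z \<and>
            \<zeta> *s (\<chi> i. deriv (\<lambda>\<omega>. f \<omega> $ i) 0) = v}"
    by (rule bdd_belowI[of _ 0]) auto
qed (rule kobayashi_metric_set_nonempty[OF assms(1,3)])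

lemma norm_le_kobayashi_metric:
  fixes \<Omega> :: "(complex ^ 'n) set"
  assumes "open \<Omega>" "bounded \<Omega>"
  obtains C where "0 < C" "\<And>z v. z \<in> \<Omega> \<Longrightarrow> norm v \<le> C * kobayashi_metric \<Omega> z v"
proof -
  obtain C where C: "0 < C"
    "\<And>f. holomorphic_disc \<Omega> f \<Longrightarrow> norm (\<chi> i. deriv (\<lambda>\<omega>. f \<omega> $ i) 0) \<le> C"
    using bounded_domain_disc_bounds[OF assms(2)] by metis
  show ?thesis
  proof (rule that[OF C(1)])
    fix z v :: "complex ^ 'n" assume z: "z \<in> \<Omega>"
    have "norm v / C \<le> kobayashi_metric \<Omega> z v"
      unfolding kobayashi_metric_def
    proof (rule cInf_greatest[OF kobayashi_metric_set_nonempty[OF assms(1) z]])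
      fix x assume "x \<in> {cmod \<zeta> | \<zeta>. \<exists>f. holomorphic_disc \<Omega> f \<and> f 0 = z \<and>
            \<zeta> *s (\<chi> i. deriv (\<lambda>\<omega>. f \<omega> $ i) 0) = v}"
      then obtain \<zeta> f where x: "x = cmod \<zeta>" and f: "holomorphic_disc \<Omega> f"
        "\<zeta> *s (\<chi> i. deriv (\<lambda>\<omega>. f \<omega> $ i) 0) = v" by blast
      have "norm v = cmod \<zeta> * norm (\<chi> i. deriv (\<lambda>\<omega>. f \<omega> $ i) 0)"
        unfolding f(2)[symmetric] by (rule norm_vector_scalar_mult)
      also have "\<dots> \<le> cmod \<zeta> * C" using C(2)[OF f(1)] by (intro mult_left_mono) auto
      finally show "norm v / C \<le> x" using C(1) x by (simp add: divide_le_eq)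
    qed
    then show "norm v \<le> C * kobayashi_metric \<Omega> z v" using C(1) by (simp add: divide_le_eq mult.commute)
  qed
qed

section \<open>Generic translations\<close>

text \<open>A bad \<open>c\<close> has the form \<open>a - f \<zeta>\<close>, and this expression is
  Lipschitz in the pair with constant \<open>L + 1\<close>.\<close>

lemma negligible_translations_meeting:
  fixes f :: "complex \<Rightarrow> 'b::euclidean_space"
  assumes "hausdorff_measure s A = 0" "0 < s" "real DIM('b) = s + 2" "bounded B" "L-lipschitz_on B f"
  shows "negligible {c. \<exists>\<zeta>\<in>B. f \<zeta> + c \<in> A}"
proof -
  have "0 \<le> L" using assms(5) by (rule lipschitz_on_nonneg)
  have "negligible {a - f \<zeta> | \<zeta> a. \<zeta> \<in> B \<and> a \<in> A}"
  proof (rule negligible_lipschitz_image_hausdorff_null[OF assms(1-4)])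
    fix \<zeta> \<zeta>' a a' assume "\<zeta> \<in> B" "\<zeta>' \<in> B"
    then have "norm (f \<zeta> - f \<zeta>') \<le> L * dist \<zeta> \<zeta>'"
      using lipschitz_onD[OF assms(5)] by (simp add: dist_norm)
    moreover have "dist (a - f \<zeta>) (a' - f \<zeta>') \<le> dist a a' + norm (f \<zeta> - f \<zeta>')"
    proof -
      have "a - f \<zeta> - (a' - f \<zeta>') = (a - a') - (f \<zeta> - f \<zeta>')" by simp
      then show ?thesis unfolding dist_norm by (metis norm_triangle_ineq4)
    qed
    moreover have "dist a a' \<le> (L + 1) * dist a a'" "L * dist \<zeta> \<zeta>' \<le> (L + 1) * dist \<zeta> \<zeta>'"
      using \<open>0 \<le> L\<close> by (auto simp: algebra_simps)
    ultimately show "dist (a - f \<zeta>) (a' - f \<zeta>') \<le> (L + 1) * (dist \<zeta> \<zeta>' + dist a a')"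
      by (simp add: distrib_left)
  qed (use \<open>0 \<le> L\<close> in simp)
  moreover have "{c. \<exists>\<zeta>\<in>B. f \<zeta> + c \<in> A} \<subseteq> {a - f \<zeta> | \<zeta> a. \<zeta> \<in> B \<and> a \<in> A}"
  proof clarify
    fix c \<zeta> assume "\<zeta> \<in> B" "f \<zeta> + c \<in> A"
    then show "\<exists>\<zeta>' a. c = a - f \<zeta>' \<and> \<zeta>' \<in> B \<and> a \<in> A"
      by (intro exI[of _ \<zeta>] exI[of _ "f \<zeta> + c"]) simp
  qed
  ultimately show ?thesis by (rule negligible_subset)
qed

text \<open>The cone consists of the directions of complex lines from \<open>z\<close> to points of
  \<open>A\<close>; a direction outside it gives a line that can meet \<open>A\<close> only in
  \<open>z\<close>. The parametrisation is Lipschitz only for bounded \<open>\<zeta>\<close>, so the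
  cone is exhausted by the countably many parts with \<open>\<zeta>\<close> in a disc of radius
  \<open>k\<close>.\<close>

lemma negligible_complex_cone:
  fixes A :: "(complex ^ 'n) set"
  assumes "hausdorff_measure s A = 0" "0 < s" "2 * real CARD('n) = s + 2" "bounded A"
  shows "negligible {\<zeta> *s (a - z) | \<zeta> a. a \<in> A}"
proof -
  obtain M where M: "\<And>a. a \<in> A \<Longrightarrow> norm (a - z) \<le> M" "0 \<le> M"
  proof -
    have "bounded ((\<lambda>a. a - z) ` A)" using assms(4) by (rule bounded_translation_minus)
    then obtain M where "0 < M" "\<forall>a\<in>A. norm (a - z) \<le> M" by (auto simp: bounded_pos)
    then show ?thesis using that[of M] by simp
  qed
  have dim: "real DIM(complex ^ 'n) = s + 2" using assms(3) by simp
  have "negligible {\<zeta> *s (a - z) | \<zeta> a. \<zeta> \<in> ball 0 (real k) \<and> a \<in> A}" for k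
  proof (rule negligible_lipschitz_image_hausdorff_null[OF assms(1,2) dim bounded_ball])
    fix \<zeta> \<zeta>' :: complex and a a' assume h: "\<zeta> \<in> ball 0 (real k)" "\<zeta>' \<in> ball 0 (real k)" "a \<in> A" "a' \<in> A"
    have "\<zeta> *s (a - z) - \<zeta>' *s (a' - z) = (\<zeta> - \<zeta>') *s (a - z) + \<zeta>' *s (a - a')"
      by (simp add: vec_eq_iff algebra_simps)
    then have "dist (\<zeta> *s (a - z)) (\<zeta>' *s (a' - z))
        \<le> cmod (\<zeta> - \<zeta>') * norm (a - z) + cmod \<zeta>' * norm (a - a')"
      unfolding dist_norm by (metis norm_triangle_ineq norm_vector_scalar_mult)
    also have "\<dots> \<le> cmod (\<zeta> - \<zeta>') * (M + real k) + (M + real k) * norm (a - a')"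
      using h M(1)[OF h(3)] M(2) by (intro add_mono mult_left_mono mult_right_mono) auto
    finally show "dist (\<zeta> *s (a - z)) (\<zeta>' *s (a' - z)) \<le> (M + real k) * (dist \<zeta> \<zeta>' + dist a a')"
      by (simp add: dist_norm algebra_simps)
  qed (use M(2) in simp)
  then have "negligible (\<Union>k. {\<zeta> *s (a - z) | \<zeta> a. \<zeta> \<in> ball 0 (real k) \<and> a \<in> A})"
    by (intro negligible_countable_Union) auto
  moreover have "{\<zeta> *s (a - z) | \<zeta> a. a \<in> A} \<subseteq> (\<Union>k. {\<zeta> *s (a - z) | \<zeta> a. \<zeta> \<in> ball 0 (real k) \<and> a \<in> A})"
  proof clarify
    fix \<zeta> a assume "a \<in> A"
    obtain k where "cmod \<zeta> < real k" using reals_Archimedean2 by blast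
    then show "\<zeta> *s (a - z) \<in> (\<Union>k. {\<zeta> *s (a - z) | \<zeta> a. \<zeta> \<in> ball 0 (real k) \<and> a \<in> A})"
      using \<open>a \<in> A\<close> by (intro UN_I[of k]) auto
  qed
  ultimately show ?thesis by (rule negligible_subset)
qed

lemma negligible_avoid_small:
  fixes N :: "'a::euclidean_space set"
  assumes "negligible N" "0 < d"
  obtains c where "c \<notin> N" "norm c < d"
proof -
  have "\<not> negligible (ball (0::'a) d)" using assms(2) by (intro open_not_negligible) auto
  then have "\<not> ball 0 d \<subseteq> N" using assms(1) negligible_subset by blast
  then obtain c where "c \<notin> N" "c \<in> ball 0 d" by blast
  then show ?thesis using that by simp
qed

lemma compact_translation_subset:
  fixes K :: "'a::real_normed_vector set"
  assumes "compact K" "open D" "K \<subseteq> D"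
  obtains d where "0 < d" "\<And>x c. x \<in> K \<Longrightarrow> norm c < d \<Longrightarrow> x + c \<in> D"
proof -
  obtain d where d: "0 < d" "(\<Union>x\<in>K. ball x d) \<subseteq> D"
    using compact_subset_open_imp_ball_epsilon_subset[OF assms] by metis
  show ?thesis
  proof (rule that[OF d(1)])
    fix x c :: 'a assume "x \<in> K" "norm c < d"
    then have "x + c \<in> ball x d" by (simp add: dist_norm)
    with d(2) \<open>x \<in> K\<close> show "x + c \<in> D" by blast
  qed
qed

text \<open>The derivatives of the coordinates are bounded on a compact disc inside the open unit
  disc. Up to the unit circle they may be unbounded, which is why discs are shrunk before they are
  translated.\<close>

lemma holomorphic_disc_lipschitz:
  fixes f :: "complex \<Rightarrow> complex ^ 'n"
  assumes "holomorphic_disc \<Omega> f" "r < 1"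
  obtains L where "L-lipschitz_on (cball 0 r) f"
proof -
  have "\<exists>B. \<forall>x\<in>cball 0 r. \<forall>y\<in>cball 0 r. cmod (f x $ i - f y $ i) \<le> B * cmod (x - y)" for i
  proof -
    have hol: "(\<lambda>\<zeta>. f \<zeta> $ i) holomorphic_on ball 0 1" using assms(1) by (simp add: holomorphic_disc_def)
    have sub: "cball 0 r \<subseteq> ball (0::complex) 1" using assms(2) by auto
    have "deriv (\<lambda>\<zeta>. f \<zeta> $ i) holomorphic_on ball 0 1" using hol by (rule holomorphic_deriv) simp
    then have "continuous_on (cball 0 r) (deriv (\<lambda>\<zeta>. f \<zeta> $ i))"
      using sub by (meson continuous_on_subset holomorphic_on_imp_continuous_on)
    then have "bounded (deriv (\<lambda>\<zeta>. f \<zeta> $ i) ` cball 0 r)"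
      by (intro compact_imp_bounded compact_continuous_image compact_cball)
    then obtain B where B: "\<forall>x\<in>cball 0 r. cmod (deriv (\<lambda>\<zeta>. f \<zeta> $ i) x) \<le> B"
      by (auto simp: bounded_iff)
    have "cmod (f x $ i - f y $ i) \<le> B * cmod (x - y)" if "x \<in> cball 0 r" "y \<in> cball 0 r" for x y
    proof (rule field_differentiable_bound[where S = "cball 0 r" and f' = "deriv (\<lambda>\<zeta>. f \<zeta> $ i)"])
      fix z assume "z \<in> cball (0::complex) r"
      then have "z \<in> ball 0 1" using sub by blast
      then show "((\<lambda>\<zeta>. f \<zeta> $ i) has_field_derivative deriv (\<lambda>\<zeta>. f \<zeta> $ i) z) (at z within cball 0 r)"
        using holomorphic_derivI[OF hol open_ball] by blast
    qed (use B that in auto)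
    then show ?thesis by blast
  qed
  then obtain B where B: "\<And>i x y. x \<in> cball 0 r \<Longrightarrow> y \<in> cball 0 r \<Longrightarrow>
      cmod (f x $ i - f y $ i) \<le> B i * cmod (x - y)"
    by metis
  show ?thesis
  proof (rule that[of "\<Sum>i\<in>UNIV. \<bar>B i\<bar>"], rule lipschitz_onI)
    fix x y assume xy: "x \<in> cball (0::complex) r" "y \<in> cball (0::complex) r"
    have "dist (f x) (f y) \<le> (\<Sum>i\<in>UNIV. cmod ((f x - f y) $ i))"
      unfolding dist_norm norm_vec_def by (rule L2_set_le_sum) simp
    also have "\<dots> \<le> (\<Sum>i\<in>UNIV. \<bar>B i\<bar> * dist x y)"
    proof (rule sum_mono)
      fix i
      have "B i * cmod (x - y) \<le> \<bar>B i\<bar> * cmod (x - y)" by (intro mult_right_mono) auto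
      with B[OF xy, of i] show "cmod ((f x - f y) $ i) \<le> \<bar>B i\<bar> * dist x y" by (simp add: dist_norm)
    qed
    finally show "dist (f x) (f y) \<le> (\<Sum>i\<in>UNIV. \<bar>B i\<bar>) * dist x y" by (simp add: sum_distrib_right)
  qed (simp add: sum_nonneg)
qed

text \<open>Makes polynomial paths available to the dimension count, which a merely continuous path
  would not satisfy.\<close>

lemma polynomial_function_lipschitz_on_interval:
  fixes g :: "real \<Rightarrow> 'a::euclidean_space"
  assumes "polynomial_function g"
  obtains L where "L-lipschitz_on {a..b} g"
proof -
  obtain g' where g': "polynomial_function g'" "\<And>x. (g has_vector_derivative g' x) (at x)"
    using has_vector_derivative_polynomial_function[OF assms] by metis
  have "compact (g' ` {a..b})"
    using g'(1) by (intro compact_continuous_image continuous_on_polymonial_function) auto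
  then obtain B where B: "\<forall>x\<in>{a..b}. norm (g' x) \<le> B" "0 < B"
    by (auto simp: bounded_pos dest!: compact_imp_bounded)
  have "dist (g x) (g y) \<le> B * dist x y" if "x \<in> {a..b}" "y \<in> {a..b}" for x y
    unfolding dist_norm
  proof (rule differentiable_bound[where S = "{a..b}" and f' = "\<lambda>x h. h *\<^sub>R g' x"])
    fix x assume "x \<in> {a..b}"
    show "(g has_derivative (\<lambda>h. h *\<^sub>R g' x)) (at x within {a..b})"
      using g'(2)[of x] unfolding has_vector_derivative_def by (rule has_derivative_at_withinI)
    show "onorm (\<lambda>h. h *\<^sub>R g' x) \<le> B"
      using B(1) \<open>x \<in> {a..b}\<close> by (intro onorm_le) (simp add: mult.commute[of B] mult_left_mono)
  qed (use that in auto)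
  then have "B-lipschitz_on {a..b} g" using B(2) by (intro lipschitz_onI) auto
  then show ?thesis by (rule that)
qed

text \<open>Replacing \<open>f\<close> by the dilated disc
  \<open>\<zeta> \<mapsto> f (r * \<zeta>)\<close> moves the parameters of the end points from
  \<open>a\<close>, \<open>b\<close> to \<open>a / r\<close>, \<open>b / r\<close>. By continuity
  the cost tends to 0 as \<open>r\<close> tends to 1 from below.\<close>

lemma poincare_dist_shrink:
  assumes "cmod a < 1" "cmod b < 1" "0 < e"
  obtains r where "0 < r" "r < 1" "cmod a < r" "cmod b < r"
    "poincare_dist (a / of_real r) (b / of_real r) < poincare_dist a b + e"
proof -
  have "(1 - cnj a * b) \<noteq> 0"
  proof
    assume "1 - cnj a * b = 0"
    then have "cmod (cnj a * b) = 1" by (metis eq_iff_diff_eq_0 norm_one)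
    moreover have "cmod (cnj a * b) < 1"
      using assms mult_strict_mono[of "cmod a" 1 "cmod b" 1] by (cases "b = 0") (auto simp: norm_mult)
    ultimately show False by simp
  qed
  moreover have "cmod ((a - b) / (1 - cnj a * b)) < 1" using assms(1,2) by (rule norm_pseudo_hyperbolic_less_1)
  moreover have "0 \<le> cmod ((a - b) / (1 - cnj a * b))" by simp
  ultimately have "((\<lambda>r. poincare_dist (a / of_real r) (b / of_real r)) \<longlongrightarrow>
      poincare_dist (a / of_real 1) (b / of_real 1)) (at_left 1)"
    unfolding poincare_dist_def by (intro tendsto_intros) (auto simp del: norm_ge_zero)
  then have "eventually (\<lambda>r. poincare_dist (a / of_real r) (b / of_real r) < poincare_dist a b + e) (at_left 1)"
    using \<open>0 < e\<close> by (intro order_tendstoD) auto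
  moreover have "eventually (\<lambda>r. r \<in> {max (cmod a) (cmod b)<..<1}) (at_left 1)"
    using assms by (intro eventually_at_leftI[of "max (cmod a) (cmod b)"]) auto
  moreover have "eventually (\<lambda>r. r \<in> {0<..<1}) (at_left (1::real))"
    by (intro eventually_at_leftI[of 0]) auto
  ultimately have "eventually (\<lambda>r. poincare_dist (a / of_real r) (b / of_real r) < poincare_dist a b + e
      \<and> r \<in> {max (cmod a) (cmod b)<..<1} \<and> r \<in> {0<..<1}) (at_left 1)"
    by (intro eventually_conj)
  then obtain r where "poincare_dist (a / of_real r) (b / of_real r) < poincare_dist a b + e"
      "r \<in> {max (cmod a) (cmod b)<..<1}" "r \<in> {0<..<1}"
    using eventually_happens'[OF trivial_limit_at_left_real] by blast
  then show ?thesis using that by auto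
qed

lemma bounded_linear_vector_scalar_mult_left:
  "bounded_linear (\<lambda>\<zeta>. \<zeta> *s (w :: complex ^ 'n))"
  by (rule bounded_linear_intro[where K = "norm w"])
    (auto simp: vec_eq_iff algebra_simps norm_vector_scalar_mult)

section \<open>Connectedness and Kobayashi distance after removal of a compact null set\<close>

locale hausdorff_null_removal =
  fixes D A :: "(complex ^ 'n) set"
  assumes card_ge_2: "2 \<le> CARD('n)"
    and domain: "is_domain D"
    and compact_A: "compact A"
    and null: "hausdorff_measure (2 * real CARD('n) - 2) A = 0"
begin

lemma open_D: "open D" and connected_D: "connected D" and D_nonempty: "D \<noteq> {}"
  using domain by (auto simp: is_domain_def)

lemma open_diff: "open (D - A)"
  using open_D compact_A by (intro open_Diff compact_imp_closed)

lemma negligible_translations: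
  fixes f :: "complex \<Rightarrow> complex ^ 'n"
  assumes "bounded B" "L-lipschitz_on B f"
  shows "negligible {c. \<exists>\<zeta>\<in>B. f \<zeta> + c \<in> A}"
  by (rule negligible_translations_meeting[OF null _ _ assms]) (use card_ge_2 in auto)

text \<open>On the closed disc of radius \<open>r < 1\<close> the map is Lipschitz with compact
  image in \<open>D\<close>: the former lets almost every translate miss \<open>A\<close>, the
  latter keeps small translates in \<open>D\<close>. The exceptional set \<open>N\<close> and the
  bound \<open>d\<close> appear in the conclusion, instead of one good \<open>c\<close>, because
  finitely many such conditions can then be met at once.\<close>

lemma disc_translate_avoids:
  assumes f: "holomorphic_disc D f" and a: "cmod a < 1" and b: "cmod b < 1" and "0 < e"
  shows "\<exists>N d. negligible N \<and> 0 < d \<and> (\<forall>c. c \<notin> N \<longrightarrow> norm c < d \<longrightarrow>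
    (\<exists>g a' b'. holomorphic_disc (D - A) g \<and> cmod a' < 1 \<and> cmod b' < 1 \<and> g a' = f a + c \<and>
       g b' = f b + c \<and> poincare_dist a' b' < poincare_dist a b + e))"
proof -
  obtain r where r: "0 < r" "r < 1" "cmod a < r" "cmod b < r"
    "poincare_dist (a / of_real r) (b / of_real r) < poincare_dist a b + e"
    using poincare_dist_shrink[OF a b \<open>0 < e\<close>] .
  obtain L where L: "L-lipschitz_on (cball 0 r) f"
    using holomorphic_disc_lipschitz[OF f r(2)] .
  define N where "N = {c. \<exists>\<zeta>\<in>cball 0 r. f \<zeta> + c \<in> A}"
  have "negligible N" unfolding N_def using L by (intro negligible_translations) auto
  have "compact (f ` cball 0 r)"
    using lipschitz_on_continuous_on[OF L] by (intro compact_continuous_image) auto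
  moreover have "f ` cball 0 r \<subseteq> D" using f r(2) by (auto simp: holomorphic_disc_def)
  ultimately obtain d where d: "0 < d" "\<And>x c. x \<in> f ` cball 0 r \<Longrightarrow> norm c < d \<Longrightarrow> x + c \<in> D"
    using compact_translation_subset[OF _ open_D] by metis
  show ?thesis
  proof (rule exI[of _ N], rule exI[of _ d], intro conjI allI impI)
    fix c assume c: "c \<notin> N" "norm c < d"
    define g where "g = (\<lambda>\<zeta>. f (of_real r * \<zeta>) + c)"
    have in_ball: "of_real r * \<zeta> \<in> cball 0 r" if "\<zeta> \<in> ball 0 1" for \<zeta> :: complex
      using that r(1) by (simp add: norm_mult)
    have "holomorphic_disc (D - A) g"
      unfolding holomorphic_disc_def
    proof
      show "\<forall>i. (\<lambda>\<zeta>. g \<zeta> $ i) holomorphic_on ball 0 1"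
      proof
        fix i
        have f1: "(\<lambda>\<zeta>. f \<zeta> $ i) holomorphic_on ball 0 1" using f by (simp add: holomorphic_disc_def)
        have "(\<lambda>\<zeta>. of_real r * \<zeta>) ` ball 0 1 \<subseteq> ball (0::complex) 1"
          using in_ball r(2) by force
        then have "(\<lambda>\<zeta>. f (of_real r * \<zeta>) $ i) holomorphic_on ball 0 1"
          using holomorphic_on_compose_gen[OF _ f1, of "\<lambda>\<zeta>. of_real r * \<zeta>" "ball 0 1"]
          by (simp add: o_def holomorphic_on_mult)
        then show "(\<lambda>\<zeta>. g \<zeta> $ i) holomorphic_on ball 0 1"
          unfolding g_def by (auto intro!: holomorphic_intros)
      qed
      show "g ` ball 0 1 \<subseteq> D - A"
        using in_ball d(2) c unfolding g_def N_def by blast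
    qed
    moreover have "cmod (a / of_real r) < 1" "cmod (b / of_real r) < 1"
      using r by (auto simp: norm_divide)
    moreover have "g (a / of_real r) = f a + c" "g (b / of_real r) = f b + c"
      using r(1) by (auto simp: g_def)
    ultimately show "\<exists>g a' b'. holomorphic_disc (D - A) g \<and> cmod a' < 1 \<and> cmod b' < 1 \<and> g a' = f a + c \<and>
       g b' = f b + c \<and> poincare_dist a' b' < poincare_dist a b + e"
      using r(5) by blast
  qed (use \<open>negligible N\<close> d in auto)
qed

text \<open>The same \<open>c\<close> serves for all links, so the translated discs still form a chain.\<close>

lemma disc_chain_translate_avoids:
  "disc_chain D z w x \<Longrightarrow> 0 < e \<Longrightarrow> \<exists>N d. negligible N \<and> 0 < d \<and> (\<forall>c. c \<notin> N \<longrightarrow> norm c < d \<longrightarrow>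
     (\<exists>y. disc_chain (D - A) (z + c) (w + c) y \<and> y < x + e))"
proof (induction arbitrary: e rule: disc_chain.induct)
  case (disc_chain_refl z)
  then show ?case
    using disc_chain.disc_chain_refl[of "D - A"] by (intro exI[of _ "{}"] exI[of _ 1]) force
next
  case (disc_chain_step z f a x b)
  then have "0 < e / 2" by simp
  obtain N d where N: "negligible N" "0 < d" "\<And>c. c \<notin> N \<Longrightarrow> norm c < d \<Longrightarrow>
     (\<exists>y. disc_chain (D - A) (z + c) (f a + c) y \<and> y < x + e / 2)"
    using disc_chain_step.IH[OF \<open>0 < e / 2\<close>] by blast
  obtain N' d' where N': "negligible N'" "0 < d'" "\<And>c. c \<notin> N' \<Longrightarrow> norm c < d' \<Longrightarrow>
     (\<exists>g a' b'. holomorphic_disc (D - A) g \<and> cmod a' < 1 \<and> cmod b' < 1 \<and> g a' = f a + c \<and>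
       g b' = f b + c \<and> poincare_dist a' b' < poincare_dist a b + e / 2)"
    using disc_translate_avoids[OF disc_chain_step.hyps(2-4) \<open>0 < e / 2\<close>] by blast
  show ?case
  proof (rule exI[of _ "N \<union> N'"], rule exI[of _ "min d d'"], intro conjI allI impI)
    fix c assume c: "c \<notin> N \<union> N'" "norm c < min d d'"
    then obtain y where y: "disc_chain (D - A) (z + c) (f a + c) y" "y < x + e / 2"
      using N(3)[of c] by auto
    obtain g a' b' where g: "holomorphic_disc (D - A) g" "cmod a' < 1" "cmod b' < 1" "g a' = f a + c"
       "g b' = f b + c" "poincare_dist a' b' < poincare_dist a b + e / 2"
      using N'(3)[of c] c by auto
    have "disc_chain (D - A) (z + c) (f b + c) (y + poincare_dist a' b')"
      using disc_chain.disc_chain_step[of "D - A" "z + c" g a' y b'] y g by simp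
    then show "\<exists>y. disc_chain (D - A) (z + c) (f b + c) y \<and> y < x + poincare_dist a b + e"
      using y(2) g(6) by (intro exI[of _ "y + poincare_dist a' b'"]) auto
  qed (use N N' in auto)
qed

lemma approximable_from_diff:
  assumes "z \<in> D" "0 < d"
  obtains y where "y \<in> D - A" "dist z y < d"
proof -
  \<comment> \<open>The one-point disc: the translation count with \<open>B = {0}\<close> and a
    constant map shows that a null set has no interior.\<close>
  have "negligible {c. \<exists>\<zeta>\<in>{0::complex}. z + c \<in> A}"
    by (rule negligible_translations[where L = 0]) (auto intro: lipschitz_onI)
  then have N: "negligible {c. z + c \<in> A}" by simp
  obtain r where r: "0 < r" "ball z r \<subseteq> D" using open_D assms(1) by (auto simp: open_contains_ball)
  have "0 < min d r" using r(1) assms(2) by simp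
  then obtain c where c: "c \<notin> {c. z + c \<in> A}" "norm c < min d r"
    using negligible_avoid_small[OF N] by metis
  then have "z + c \<in> D - A" "dist z (z + c) < d" using r(2) by (auto simp: dist_norm subset_iff)
  then show ?thesis by (rule that)
qed

text \<open>Two points of \<open>D - A\<close> are joined in \<open>D\<close> by a polynomial path,
  a generic small translate of which misses \<open>A\<close>. Straight segments in balls around the
  two points join them to the ends of the translated path.\<close>

lemma domain_diff: "is_domain (D - A)"
proof -
  obtain z where "z \<in> D" using D_nonempty by blast
  then have "D - A \<noteq> {}" using approximable_from_diff[of z 1] by force
  moreover have "path_connected (D - A)"
    unfolding path_connected_component
  proof (intro ballI)
    fix x y assume xy: "x \<in> D - A" "y \<in> D - A"
    obtain g where g: "polynomial_function g" "path_image g \<subseteq> D" "pathstart g = x" "pathfinish g = y"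
      using connected_open_polynomial_connected[OF open_D connected_D, of x y] xy by blast
    obtain L where L: "L-lipschitz_on {0..1} g"
      using polynomial_function_lipschitz_on_interval[OF g(1)] .
    \<comment> \<open>The path is read as a map on the segment from 0 to 1 in the complex plane, so
      that the count for discs covers it too.\<close>
    have "L-lipschitz_on (of_real ` {0..1}) (\<lambda>\<zeta>. g (Re \<zeta>))"
      using L by (auto simp: lipschitz_on_def dist_norm simp flip: of_real_diff)
    moreover have "bounded (complex_of_real ` {0..1})"
      by (intro compact_imp_bounded compact_continuous_image continuous_intros) auto
    moreover define N where "N = {c. \<exists>\<zeta>\<in>complex_of_real ` {0..1}. g (Re \<zeta>) + c \<in> A}"
    ultimately have N: "negligible N"
      unfolding N_def by (intro negligible_translations)
    have "compact (path_image g)" using g(1) by (intro compact_path_image path_polynomial_function)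
    then obtain d where d: "0 < d" "\<And>u c. u \<in> path_image g \<Longrightarrow> norm c < d \<Longrightarrow> u + c \<in> D"
      using compact_translation_subset[OF _ open_D g(2)] by metis
    obtain dx where dx: "0 < dx" "ball x dx \<subseteq> D - A"
      using open_diff xy(1) by (auto simp: open_contains_ball)
    obtain dy where dy: "0 < dy" "ball y dy \<subseteq> D - A"
      using open_diff xy(2) by (auto simp: open_contains_ball)
    have "0 < min d (min dx dy)" using d(1) dx(1) dy(1) by simp
    from negligible_avoid_small[OF N this]
    obtain c where c: "c \<notin> N" "norm c < min d (min dx dy)" by metis
    have local: "path_component (D - A) u (u + c)" if "0 < r" "ball u r \<subseteq> D - A" "norm c < r" for u r
    proof -
      have "path_component (ball u r) u (u + c)"
        using convex_imp_path_connected[OF convex_ball, of u r] that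
        by (auto simp: path_connected_component dist_norm)
      then show ?thesis using that(2) path_component_of_subset by blast
    qed
    have "path_component (D - A) (x + c) (y + c)"
      unfolding path_component_def
    proof (intro exI[of _ "\<lambda>t. g t + c"] conjI)
      show "path (\<lambda>t. g t + c)"
        using path_polynomial_function[OF g(1)] by (auto simp: path_def intro!: continuous_intros)
      show "path_image (\<lambda>t. g t + c) \<subseteq> D - A"
      proof
        fix u assume "u \<in> path_image (\<lambda>t. g t + c)"
        then obtain t where t: "t \<in> {0..1}" "u = g t + c" by (auto simp: path_image_def)
        then have "g t + c \<in> D" using c(2) by (intro d(2)) (auto simp: path_image_def)
        moreover have "g t + c \<notin> A" using c(1) t(1) unfolding N_def by force
        ultimately show "u \<in> D - A" using t(2) by simp
      qed
    qed (use g in \<open>auto simp: pathstart_def pathfinish_def\<close>)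
    moreover have "path_component (D - A) x (x + c)" "path_component (D - A) y (y + c)"
      using local[OF dx] local[OF dy] c(2) by auto
    ultimately show "path_component (D - A) x y"
      using path_component_trans path_component_sym by meson
  qed
  ultimately show ?thesis
    using open_diff path_connected_imp_connected by (auto simp: is_domain_def)
qed

text \<open>Four errors of \<open>e / 4\<close>: the choice of a nearly optimal chain in
  \<open>D\<close>, the loss in translating it, and the displacement of each of the two end points,
  measured in \<open>D - A\<close>.\<close>

lemma kobayashi_dist_diff:
  assumes z: "z \<in> D - A" and w: "w \<in> D - A"
  shows "kobayashi_dist (D - A) z w = kobayashi_dist D z w"
proof (rule antisym)
  show "kobayashi_dist D z w \<le> kobayashi_dist (D - A) z w"
    using kobayashi_dist_antimono[OF domain_diff _ z w] by blast
  show "kobayashi_dist (D - A) z w \<le> kobayashi_dist D z w"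
  proof (rule field_le_epsilon)
    fix e :: real assume "0 < e"
    then have e4: "0 < e / 4" by simp
    have zw: "z \<in> D" "w \<in> D" using z w by auto
    obtain x where x: "disc_chain D z w x" "x < kobayashi_dist D z w + e / 4"
      using kobayashi_dist_chain[OF domain zw e4] .
    obtain N d where N: "negligible N" "0 < d" "\<And>c. c \<notin> N \<Longrightarrow> norm c < d \<Longrightarrow>
       (\<exists>y. disc_chain (D - A) (z + c) (w + c) y \<and> y < x + e / 4)"
      using disc_chain_translate_avoids[OF x(1) e4] by blast
    obtain dz where dz: "0 < dz" "ball z dz \<subseteq> D - A" "\<And>u. dist z u < dz \<Longrightarrow> kobayashi_dist (D - A) z u < e / 4"
      using kobayashi_dist_small[OF open_diff z e4] by metis
    obtain dw where dw: "0 < dw" "ball w dw \<subseteq> D - A" "\<And>u. dist w u < dw \<Longrightarrow> kobayashi_dist (D - A) w u < e / 4"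
      using kobayashi_dist_small[OF open_diff w e4] by metis
    have "0 < min d (min dz dw)" using N(2) dz(1) dw(1) by simp
    from negligible_avoid_small[OF N(1) this]
    obtain c where c: "c \<notin> N" "norm c < min d (min dz dw)" by metis
    then obtain y where y: "disc_chain (D - A) (z + c) (w + c) y" "y < x + e / 4"
      using N(3)[of c] by auto
    have zc: "dist z (z + c) < dz" "dist w (w + c) < dw" using c(2) by (auto simp: dist_norm)
    then have in_diff: "z + c \<in> D - A" "w + c \<in> D - A" using dz(2) dw(2) by auto
    have "kobayashi_dist (D - A) z w
        \<le> kobayashi_dist (D - A) z (z + c) + kobayashi_dist (D - A) (z + c) w"
      by (rule kobayashi_dist_triangle[OF domain_diff z in_diff(1) w])
    also have "kobayashi_dist (D - A) (z + c) w
        \<le> kobayashi_dist (D - A) (z + c) (w + c) + kobayashi_dist (D - A) (w + c) w"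
      by (rule kobayashi_dist_triangle[OF domain_diff in_diff w])
    finally show "kobayashi_dist (D - A) z w \<le> kobayashi_dist D z w + e"
      using dz(3)[OF zc(1)] dw(3)[OF zc(2)] kobayashi_dist_commute[of "D - A" w "w + c"]
        kobayashi_dist_le[OF in_diff y(1)] y(2) x(2) by linarith
  qed
qed

end

section \<open>Visibility\<close>

text \<open>The bound on the metric turns into a Euclidean bound on the derivative almost
  everywhere, and absolute continuity integrates it. The factor \<open>C\<close> depends on
  \<open>\<Omega>\<close> alone, so the curves with a fixed \<open>l\<close> are
  equicontinuous.\<close>

lemma almost_geodesic_lipschitz:
  fixes \<Omega> :: "(complex ^ 'n) set"
  assumes "open \<Omega>" "bounded \<Omega>"
  obtains C where "0 < C" "\<And>l \<kappa> a b \<sigma>. 0 \<le> l \<Longrightarrow> almost_geodesic \<Omega> l \<kappa> {a..b} \<sigma> \<Longrightarrow> (C * l)-lipschitz_on {a..b} \<sigma>"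
proof -
  obtain C where C: "0 < C" "\<And>z v. z \<in> \<Omega> \<Longrightarrow> norm v \<le> C * kobayashi_metric \<Omega> z v"
    using norm_le_kobayashi_metric[OF assms] by metis
  show ?thesis
  proof (rule that[OF C(1)])
    fix l \<kappa> a b \<sigma> assume "0 \<le> l" and geo: "almost_geodesic \<Omega> l \<kappa> {a..b} \<sigma>"
    then have in_\<Omega>: "\<sigma> ` {a..b} \<subseteq> \<Omega>" and ac: "absolutely_continuous_on {a..b} \<sigma>"
      and ae: "AE t in lebesgue. t \<in> {a..b} \<longrightarrow> \<sigma> differentiable (at t within {a..b}) \<and>
        kobayashi_metric \<Omega> (\<sigma> t) (vector_derivative \<sigma> (at t within {a..b})) \<le> l"
      by (auto simp: almost_geodesic_def)
    have le: "norm (\<sigma> t - \<sigma> s) \<le> C * l * (t - s)" if st: "s \<in> {a..b}" "t \<in> {a..b}" "s \<le> t" for s t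
    proof (rule absolutely_continuous_bounded_derivative)
      have sub: "{s..t} \<subseteq> {a..b}" using st by auto
      show "absolutely_continuous_on {s..t} \<sigma>" using ac sub by (rule absolutely_continuous_on_subset)
      from ae show "AE u in lebesgue. u \<in> {s..t} \<longrightarrow>
          (\<exists>v. (\<sigma> has_vector_derivative v) (at u within {s..t}) \<and> norm v \<le> C * l)"
      proof (rule eventually_mono, intro impI)
        fix u assume u: "u \<in> {a..b} \<longrightarrow> \<sigma> differentiable (at u within {a..b}) \<and>
          kobayashi_metric \<Omega> (\<sigma> u) (vector_derivative \<sigma> (at u within {a..b})) \<le> l" and "u \<in> {s..t}"
        let ?v = "vector_derivative \<sigma> (at u within {a..b})"
        have "u \<in> {a..b}" using \<open>u \<in> {s..t}\<close> sub by blast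
        with u have "(\<sigma> has_vector_derivative ?v) (at u within {a..b})" "kobayashi_metric \<Omega> (\<sigma> u) ?v \<le> l"
          using vector_derivative_works by blast+
        moreover have "norm ?v \<le> C * kobayashi_metric \<Omega> (\<sigma> u) ?v"
          using in_\<Omega> \<open>u \<in> {a..b}\<close> by (intro C(2)) auto
        ultimately have "norm ?v \<le> C * l"
          using C(1) by (meson mult_left_mono less_imp_le order_trans)
        with \<open>(\<sigma> has_vector_derivative ?v) (at u within {a..b})\<close>
        show "\<exists>v. (\<sigma> has_vector_derivative v) (at u within {s..t}) \<and> norm v \<le> C * l"
          using has_vector_derivative_within_subset[OF _ sub] by blast
      qed
    qed (use st \<open>0 \<le> l\<close> C(1) in auto)
    show "(C * l)-lipschitz_on {a..b} \<sigma>"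
    proof (rule lipschitz_onI)
      fix s t assume "s \<in> {a..b}" "t \<in> {a..b}"
      then show "dist (\<sigma> s) (\<sigma> t) \<le> C * l * dist s t"
        using le[of s t] le[of t s] by (cases "s \<le> t") (auto simp: dist_norm norm_minus_commute)
    qed (use \<open>0 \<le> l\<close> C(1) in simp)
  qed
qed

lemma tendsto_of_infdist_tendsto_0:
  fixes x :: "nat \<Rightarrow> 'a::metric_space"
  assumes "x \<longlonglongrightarrow> l" "(\<lambda>n. infdist (x n) S) \<longlonglongrightarrow> 0" "closed S" "S \<noteq> {}"
  shows "l \<in> S"
proof -
  have "(\<lambda>n. infdist (x n) S) \<longlonglongrightarrow> infdist l S" using assms(1) by (rule tendsto_infdist)
  then have "infdist l S = 0" using assms(2) LIMSEQ_unique by blast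
  then show ?thesis using assms(3,4) by (simp add: in_closed_iff_infdist_zero)
qed

text \<open>Continued by constants beyond their right end points, the curves live on the common interval
  \<open>{0..T}\<close>, where Arzela-Ascoli applies.\<close>

lemma lipschitz_curves_limit:
  fixes \<sigma> :: "nat \<Rightarrow> real \<Rightarrow> 'a::euclidean_space"
  assumes lip: "\<And>n. L-lipschitz_on {a n..b n} (\<sigma> n)"
    and ab: "\<And>n. a n \<le> b n" "\<And>n. b n - a n \<le> T"
    and "closed S" "S \<noteq> {}" "bounded S"
    and near: "\<And>n t. t \<in> {a n..b n} \<Longrightarrow> infdist (\<sigma> n t) S \<le> inverse (real (Suc n))"
    and bd: "bounded (\<Union>n. \<sigma> n ` {a n..b n})"
    and VW: "\<And>n. \<sigma> n (a n) \<in> V" "\<And>n. \<sigma> n (b n) \<in> W"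
  obtains g where "L-lipschitz_on {0..T} g" "g ` {0..T} \<subseteq> S" "g 0 \<in> closure V" "g T \<in> closure W"
proof -
  have "0 \<le> T" using ab(1)[of 0] ab(2)[of 0] by linarith
  have "0 \<le> L" using lip[of 0] by (rule lipschitz_on_nonneg)
  define p where "p n t = a n + min t (b n - a n)" for n t
  define F where "F n t = \<sigma> n (p n t)" for n t
  have p_in: "p n t \<in> {a n..b n}" if "t \<in> {0..T}" for n t
    using that ab(1)[of n] by (auto simp: p_def)
  have p_lip: "dist (p n s) (p n t) \<le> dist s t" for n s t
    by (auto simp: p_def dist_real_def min_def)
  have F_lip: "dist (F n s) (F n t) \<le> L * dist s t" if "s \<in> {0..T}" "t \<in> {0..T}" for n s t
  proof -
    have "dist (F n s) (F n t) \<le> L * dist (p n s) (p n t)"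
      unfolding F_def by (rule lipschitz_onD[OF lip p_in[OF that(1)] p_in[OF that(2)]])
    also have "\<dots> \<le> L * dist s t" using p_lip \<open>0 \<le> L\<close> by (intro mult_left_mono)
    finally show ?thesis .
  qed
  obtain M where M: "\<forall>x\<in>\<Union>n. \<sigma> n ` {a n..b n}. norm x \<le> M"
    using bd unfolding bounded_iff ..
  obtain g k where k: "strict_mono (k :: nat \<Rightarrow> nat)" and
    conv: "\<And>e. 0 < e \<Longrightarrow> \<exists>N. \<forall>n x. N \<le> n \<and> x \<in> {0..T} \<longrightarrow> norm (F (k n) x - g x) < e"
  proof (rule Arzela_Ascoli[of "{0..T}" F M])
    show "norm (F n x) \<le> M" if "x \<in> {0..T}" for n x
      unfolding F_def by (rule bspec[OF M], rule UN_I[OF UNIV_I], rule imageI, rule p_in[OF that])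
    show "\<exists>d>0. \<forall>n y. y \<in> {0..T} \<and> norm (x - y) < d \<longrightarrow> norm (F n x - F n y) < e"
      if x: "x \<in> {0..T}" and "0 < e" for x e
    proof (rule exI[of _ "e / (L + 1)"], intro conjI allI impI)
      show "0 < e / (L + 1)" using \<open>0 < e\<close> \<open>0 \<le> L\<close> by simp
      fix n y assume y: "y \<in> {0..T} \<and> norm (x - y) < e / (L + 1)"
      have "norm (F n x - F n y) \<le> L * norm (x - y)" using F_lip[OF x, of y n] y by (simp add: dist_norm)
      also have "\<dots> \<le> L * (e / (L + 1))" using y \<open>0 \<le> L\<close> by (intro mult_left_mono) auto
      also have "\<dots> < e" using \<open>0 < e\<close> \<open>0 \<le> L\<close> by (simp add: field_simps)
      finally show "norm (F n x - F n y) < e" .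
    qed
  qed (use that in auto)
  have lim: "(\<lambda>n. F (k n) t) \<longlonglongrightarrow> g t" if "t \<in> {0..T}" for t
    unfolding LIMSEQ_iff using conv that by meson
  have "L-lipschitz_on {0..T} g"
  proof (rule lipschitz_onI)
    fix s t assume st: "s \<in> {0..T}" "t \<in> {0..T}"
    have "(\<lambda>n. dist (F (k n) s) (F (k n) t)) \<longlonglongrightarrow> dist (g s) (g t)"
      by (intro tendsto_dist lim st)
    then show "dist (g s) (g t) \<le> L * dist s t"
      by (rule LIMSEQ_le_const2) (use F_lip[OF st] in blast)
  qed (rule \<open>0 \<le> L\<close>)
  moreover have "g ` {0..T} \<subseteq> S"
  proof clarify
    fix t assume t: "t \<in> {0..T}"
    have "(\<lambda>n. infdist (F (k n) t) S) \<longlonglongrightarrow> 0"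
    proof (rule tendsto_sandwich[OF _ _ tendsto_const LIMSEQ_inverse_real_of_nat])
      show "\<forall>\<^sub>F n in sequentially. infdist (F (k n) t) S \<le> inverse (real (Suc n))"
      proof (intro always_eventually allI)
        fix n
        have "infdist (F (k n) t) S \<le> inverse (real (Suc (k n)))"
          unfolding F_def by (intro near p_in t)
        also have "\<dots> \<le> inverse (real (Suc n))"
          using seq_suble[OF k, of n] by (intro le_imp_inverse_le) auto
        finally show "infdist (F (k n) t) S \<le> inverse (real (Suc n))" .
      qed
    qed (simp add: infdist_nonneg)
    with lim[OF t] show "g t \<in> S" using assms(4,5) by (rule tendsto_of_infdist_tendsto_0)
  qed
  moreover have "g 0 \<in> closure V"
  proof (rule closed_sequentially[OF closed_closure])
    show "(\<lambda>n. F (k n) 0) \<longlonglongrightarrow> g 0" using \<open>0 \<le> T\<close> by (intro lim) auto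
    have "F n 0 = \<sigma> n (a n)" for n using ab(1)[of n] by (simp add: F_def p_def)
    then show "F (k n) 0 \<in> closure V" for n using VW(1) closure_subset by auto
  qed
  moreover have "g T \<in> closure W"
  proof (rule closed_sequentially[OF closed_closure])
    show "(\<lambda>n. F (k n) T) \<longlonglongrightarrow> g T" using \<open>0 \<le> T\<close> by (intro lim) auto
    have "F n T = \<sigma> n (b n)" for n using ab(2)[of n] by (simp add: F_def p_def)
    then show "F (k n) T \<in> closure W" for n using VW(2) closure_subset by auto
  qed
  ultimately show ?thesis by (rule that)
qed

lemma infdist_ge_of_dist_ge:
  assumes "S \<noteq> {}" "\<And>y. y \<in> S \<Longrightarrow> d \<le> dist x y"
  shows "d \<le> infdist x S"
  using assms by (simp add: infdist_notempty cINF_greatest)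

lemma visibility_domainD:
  assumes "visibility_domain \<Omega>" and prem: "1 \<le> l" "0 \<le> \<kappa>" "\<xi> \<in> frontier \<Omega>" "\<eta> \<in> frontier \<Omega>" "\<xi> \<noteq> \<eta>"
    "openin (top_of_set (closure \<Omega>)) V" "openin (top_of_set (closure \<Omega>)) W"
    "\<xi> \<in> V" "\<eta> \<in> W" "closure V \<inter> closure W = {}"
  obtains K where "compact K" "K \<subseteq> \<Omega>" "\<And>a b \<sigma>. a \<le> b \<Longrightarrow> almost_geodesic \<Omega> l \<kappa> {a..b} \<sigma> \<Longrightarrow>
      \<sigma> a \<in> V \<Longrightarrow> \<sigma> b \<in> W \<Longrightarrow> \<sigma> ` {a..b} \<inter> K \<noteq> {}"
proof -
  have "\<exists>K. compact K \<and> K \<subseteq> \<Omega> \<and> (\<forall>a b \<sigma>. a \<le> b \<and> almost_geodesic \<Omega> l \<kappa> {a..b} \<sigma> \<and>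
      \<sigma> a \<in> V \<and> \<sigma> b \<in> W \<longrightarrow> \<sigma> ` {a..b} \<inter> K \<noteq> {})"
    by (rule assms(1)[unfolded visibility_domain_def, THEN conjunct2, THEN conjunct2, rule_format,
          of l \<kappa> \<xi> \<eta> V W]) (intro conjI prem)
  then obtain K where K: "compact K" "K \<subseteq> \<Omega>" "\<forall>a b \<sigma>. a \<le> b \<and> almost_geodesic \<Omega> l \<kappa> {a..b} \<sigma> \<and>
      \<sigma> a \<in> V \<and> \<sigma> b \<in> W \<longrightarrow> \<sigma> ` {a..b} \<inter> K \<noteq> {}"
    by (elim exE conjE)
  show ?thesis
    by (rule that[OF K(1,2)]) (rule K(3)[rule_format], intro conjI)
qed

context hausdorff_null_removal
begin

lemma almost_geodesic_diff:
  assumes geo: "almost_geodesic (D - A) l \<kappa> I \<sigma>"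
  shows "almost_geodesic D l \<kappa> I \<sigma>"
proof -
  have im: "\<sigma> t \<in> D - A" if "t \<in> I" for t using geo that by (auto simp: almost_geodesic_def)
  have "AE t in lebesgue. t \<in> I \<longrightarrow> \<sigma> differentiable (at t within I) \<and>
        kobayashi_metric (D - A) (\<sigma> t) (vector_derivative \<sigma> (at t within I)) \<le> l"
    using geo by (simp add: almost_geodesic_def)
  then have "AE t in lebesgue. t \<in> I \<longrightarrow> \<sigma> differentiable (at t within I) \<and>
        kobayashi_metric D (\<sigma> t) (vector_derivative \<sigma> (at t within I)) \<le> l"
  proof (rule eventually_mono, intro impI)
    fix t
    assume *: "t \<in> I \<longrightarrow> \<sigma> differentiable (at t within I) \<and>
        kobayashi_metric (D - A) (\<sigma> t) (vector_derivative \<sigma> (at t within I)) \<le> l" and "t \<in> I"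
    then show "\<sigma> differentiable (at t within I) \<and>
        kobayashi_metric D (\<sigma> t) (vector_derivative \<sigma> (at t within I)) \<le> l"
      using kobayashi_metric_antimono[OF open_diff Diff_subset im[OF \<open>t \<in> I\<close>]] order_trans by blast
  qed
  moreover have "kobayashi_dist D (\<sigma> s) (\<sigma> t) = kobayashi_dist (D - A) (\<sigma> s) (\<sigma> t)"
    if "s \<in> I" "t \<in> I" for s t
    using kobayashi_dist_diff[OF im[OF that(1)] im[OF that(2)]] by simp
  ultimately show ?thesis using geo by (auto simp: almost_geodesic_def)
qed

text \<open>Visibility of \<open>D\<close> cannot be applied to \<open>V\<close> and
  \<open>W\<close>, which may surround points of \<open>A\<close>. For a sequence of offending
  curves the end points subconverge to boundary points of \<open>D\<close>, distinct because the
  closures of \<open>V\<close> and \<open>W\<close> are disjoint, and visibility is applied to small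
  balls around these limits. Its compact set has positive distance from the complement of
  \<open>D\<close>, to which the curves stay arbitrarily close.\<close>

lemma no_almost_geodesics_near_boundary:
  assumes vis: "visibility_domain D" and l: "1 \<le> l" "0 \<le> \<kappa>"
    and VW: "V \<subseteq> closure D" "W \<subseteq> closure D" "closure V \<inter> closure W = {}"
  shows "\<exists>e>0. \<forall>a b \<sigma>. a \<le> b \<longrightarrow> almost_geodesic (D - A) l \<kappa> {a..b} \<sigma> \<longrightarrow> \<sigma> a \<in> V \<longrightarrow> \<sigma> b \<in> W \<longrightarrow>
           (\<exists>t\<in>{a..b}. e \<le> infdist (\<sigma> t) (- D))"
proof (rule ccontr)
  assume neg: "\<not> ?thesis"
  have "bounded D" using vis by (simp add: visibility_domain_def)
  \<comment> \<open>\<open>infdist\<close> to the empty set is 0 by convention, so distances to the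
    complement carry information only when it is non-empty.\<close>
  then have ne: "- D \<noteq> {}" using not_bounded_UNIV by (metis Compl_empty_eq double_complement)
  have cl: "closed (- D)" using open_D by (rule closed_Compl)
  have "\<exists>a b \<sigma>. a \<le> b \<and> almost_geodesic (D - A) l \<kappa> {a..b} \<sigma> \<and> \<sigma> a \<in> V \<and> \<sigma> b \<in> W \<and>
          (\<forall>t\<in>{a..b}. infdist (\<sigma> t) (- D) < inverse (real (Suc n)))" for n
  proof -
    have "0 < inverse (real (Suc n))" by simp
    with neg show ?thesis by (meson linorder_not_le)
  qed
  then obtain a b \<sigma> where ab: "\<And>n. a n \<le> b n"
    and geo: "\<And>n. almost_geodesic (D - A) l \<kappa> {a n..b n} (\<sigma> n)"
    and V: "\<And>n. \<sigma> n (a n) \<in> V" and W: "\<And>n. \<sigma> n (b n) \<in> W"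
    and near: "\<And>n t. t \<in> {a n..b n} \<Longrightarrow> infdist (\<sigma> n t) (- D) < inverse (real (Suc n))"
    by metis
  have "compact (closure D)" using \<open>bounded D\<close> by simp
  then have "compact (closure D \<times> closure D)" by (intro compact_Times)
  then have sc: "seq_compact (closure D \<times> closure D)" by (rule compact_imp_seq_compact)
  have seq: "\<forall>n. (\<sigma> n (a n), \<sigma> n (b n)) \<in> closure D \<times> closure D"
    using subsetD[OF VW(1) V] subsetD[OF VW(2) W] by simp
  obtain q and r :: "nat \<Rightarrow> nat" where q: "strict_mono r"
      "((\<lambda>n. (\<sigma> n (a n), \<sigma> n (b n))) \<circ> r) \<longlonglongrightarrow> q"
    by (rule seq_compactE[OF sc seq]) (rule that)
  define \<xi> \<eta> where "\<xi> = fst q" and "\<eta> = snd q"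
  have lim: "(\<lambda>n. \<sigma> (r n) (a (r n))) \<longlonglongrightarrow> \<xi>" "(\<lambda>n. \<sigma> (r n) (b (r n))) \<longlonglongrightarrow> \<eta>"
    using tendsto_fst[OF q(2)] tendsto_snd[OF q(2)] by (auto simp: \<xi>_def \<eta>_def o_def)
  have "\<xi> \<in> closure V" by (rule closed_sequentially[OF closed_closure _ lim(1)]) (rule subsetD[OF closure_subset V])
  moreover have "\<eta> \<in> closure W" by (rule closed_sequentially[OF closed_closure _ lim(2)]) (rule subsetD[OF closure_subset W])
  ultimately have "\<xi> \<noteq> \<eta>" using VW(3) by blast
  have r_le: "inverse (real (Suc (r n))) \<le> inverse (real (Suc n))" for n
    using seq_suble[OF q(1), of n] by (intro le_imp_inverse_le) auto
  have inf0: "(\<lambda>n. infdist (\<sigma> (r n) (t n)) (- D)) \<longlonglongrightarrow> 0" if "\<And>n. t n \<in> {a (r n)..b (r n)}" for t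
  proof (rule tendsto_sandwich[OF _ _ tendsto_const LIMSEQ_inverse_real_of_nat])
    show "\<forall>\<^sub>F n in sequentially. infdist (\<sigma> (r n) (t n)) (- D) \<le> inverse (real (Suc n))"
      by (intro always_eventually allI order_trans[OF less_imp_le[OF near[OF that]] r_le])
  qed (simp add: infdist_nonneg)
  have "\<xi> \<in> - D" by (rule tendsto_of_infdist_tendsto_0[OF lim(1) inf0 cl ne]) (use ab in simp)
  moreover have "\<eta> \<in> - D" by (rule tendsto_of_infdist_tendsto_0[OF lim(2) inf0 cl ne]) (use ab in simp)
  moreover have "\<xi> \<in> closure D" "\<eta> \<in> closure D"
    using \<open>\<xi> \<in> closure V\<close> \<open>\<eta> \<in> closure W\<close> closure_minimal[OF VW(1) closed_closure]
      closure_minimal[OF VW(2) closed_closure] by blast+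
  ultimately have fr: "\<xi> \<in> frontier D" "\<eta> \<in> frontier D"
    using open_D by (auto simp: frontier_def interior_open)
  \<comment> \<open>A third of the distance makes even the closed balls disjoint, hence also the
    closures of \<open>V'\<close> and \<open>W'\<close>.\<close>
  define \<rho> where "\<rho> = dist \<xi> \<eta> / 3"
  have "0 < \<rho>" using \<open>\<xi> \<noteq> \<eta>\<close> by (simp add: \<rho>_def)
  define V' W' where "V' = closure D \<inter> ball \<xi> \<rho>" and "W' = closure D \<inter> ball \<eta> \<rho>"
  have open': "openin (top_of_set (closure D)) V'" "openin (top_of_set (closure D)) W'"
    unfolding V'_def W'_def by (auto intro: openin_open_Int)
  have "closure V' \<subseteq> cball \<xi> \<rho>" "closure W' \<subseteq> cball \<eta> \<rho>"
    unfolding V'_def W'_def by (rule closure_minimal; auto)+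
  moreover have "cball \<xi> \<rho> \<inter> cball \<eta> \<rho> = {}"
  proof -
    have False if "dist \<xi> x \<le> \<rho>" "dist \<eta> x \<le> \<rho>" for x
      using dist_triangle2[of \<xi> \<eta> x] that \<open>0 < \<rho>\<close> unfolding \<rho>_def by linarith
    then show ?thesis by auto
  qed
  ultimately have disj: "closure V' \<inter> closure W' = {}" by blast
  have in': "\<xi> \<in> V'" "\<eta> \<in> W'"
    using \<open>\<xi> \<in> closure D\<close> \<open>\<eta> \<in> closure D\<close> \<open>0 < \<rho>\<close> by (auto simp: V'_def W'_def)
  obtain K where K: "compact K" "K \<subseteq> D" "\<And>a b \<sigma>. a \<le> b \<Longrightarrow> almost_geodesic D l \<kappa> {a..b} \<sigma> \<Longrightarrow>
      \<sigma> a \<in> V' \<Longrightarrow> \<sigma> b \<in> W' \<Longrightarrow> \<sigma> ` {a..b} \<inter> K \<noteq> {}"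
    by (rule visibility_domainD[OF vis l fr \<open>\<xi> \<noteq> \<eta>\<close> open' in' disj]) (rule that)
  obtain d where d: "0 < d" "\<And>x y. x \<in> K \<Longrightarrow> y \<in> - D \<Longrightarrow> d \<le> dist x y"
    using separate_compact_closed[OF K(1) cl] K(2) by blast
  have "\<forall>\<^sub>F n in sequentially. \<sigma> (r n) (a (r n)) \<in> ball \<xi> \<rho>"
    using lim(1) \<open>0 < \<rho>\<close> by (intro topological_tendstoD) auto
  moreover have "\<forall>\<^sub>F n in sequentially. \<sigma> (r n) (b (r n)) \<in> ball \<eta> \<rho>"
    using lim(2) \<open>0 < \<rho>\<close> by (intro topological_tendstoD) auto
  moreover have "\<forall>\<^sub>F n in sequentially. inverse (real (Suc n)) < d"
    using LIMSEQ_inverse_real_of_nat d(1) by (intro order_tendstoD(2))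
  ultimately have "\<forall>\<^sub>F n in sequentially. \<sigma> (r n) (a (r n)) \<in> ball \<xi> \<rho> \<and>
      \<sigma> (r n) (b (r n)) \<in> ball \<eta> \<rho> \<and> inverse (real (Suc n)) < d"
    by (intro eventually_conj)
  then obtain n where n: "\<sigma> (r n) (a (r n)) \<in> ball \<xi> \<rho>" "\<sigma> (r n) (b (r n)) \<in> ball \<eta> \<rho>"
      "inverse (real (Suc n)) < d"
    using eventually_happens'[OF sequentially_bot] by blast
  have "\<sigma> (r n) ` {a (r n)..b (r n)} \<inter> K \<noteq> {}"
  proof (rule K(3)[OF ab almost_geodesic_diff[OF geo]])
    show "\<sigma> (r n) (a (r n)) \<in> V'" "\<sigma> (r n) (b (r n)) \<in> W'"
      using n V W VW by (auto simp: V'_def W'_def)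
  qed
  then obtain t where t: "t \<in> {a (r n)..b (r n)}" "\<sigma> (r n) t \<in> K" by blast
  have "d \<le> infdist (\<sigma> (r n) t) (- D)" using d(2)[OF t(2)] ne by (intro infdist_ge_of_dist_ge)
  with near[OF t(1)] r_le[of n] n(3) show False by linarith
qed

text \<open>Offending curves lie in a compact neighbourhood of \<open>A\<close> inside
  \<open>D\<close>, where the distance of \<open>D\<close> is at most some \<open>B\<close>. They
  are almost-geodesics of \<open>D\<close> as well, and the lower bound in that definition limits
  the parameter length to \<open>l * (B + \<kappa>)\<close>, uniformly along the sequence. This is
  what allows a limit on one common interval.\<close>

lemma no_almost_geodesics_near_removed_set:
  assumes "bounded D" and l: "1 \<le> l" "0 \<le> \<kappa>" and A: "A \<noteq> {}" "A \<subseteq> D"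
    and curves: "\<And>(I :: real set) (\<phi> :: real \<Rightarrow> complex ^ 'n).
           is_interval I \<Longrightarrow> \<phi> ` I \<subseteq> A \<Longrightarrow> (\<exists>L. L-lipschitz_on I \<phi>) \<Longrightarrow> \<phi> constant_on I"
    and VW: "closure V \<inter> closure W = {}"
  shows "\<exists>e>0. \<forall>a b \<sigma>. a \<le> b \<longrightarrow> almost_geodesic (D - A) l \<kappa> {a..b} \<sigma> \<longrightarrow> \<sigma> a \<in> V \<longrightarrow> \<sigma> b \<in> W \<longrightarrow>
           (\<exists>t\<in>{a..b}. e \<le> infdist (\<sigma> t) A)"
proof (rule ccontr)
  assume neg: "\<not> ?thesis"
  have bdd: "bounded (D - A)" using assms(1) by (rule bounded_subset) blast
  have ne: "- D \<noteq> {}" using assms(1) not_bounded_UNIV by (metis Compl_empty_eq double_complement)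
  have cl: "closed (- D)" using open_D by (rule closed_Compl)
  obtain d where d: "0 < d" "\<And>x y. x \<in> A \<Longrightarrow> y \<in> - D \<Longrightarrow> d \<le> dist x y"
    using separate_compact_closed[OF compact_A cl] A(2) by blast
  \<comment> \<open>Half the distance between \<open>A\<close> and the complement of
    \<open>D\<close> keeps this closed neighbourhood inside \<open>D\<close>.\<close>
  define N where "N = {z. infdist z A \<le> d / 2}"
  have "compact N" unfolding N_def using A(1) compact_A d(1) by (intro compact_infdist_le) auto
  have "N \<subseteq> D"
  proof
    fix z assume "z \<in> N"
    have "d \<le> infdist z A" if "z \<in> - D"
      using d(2)[OF _ that] A(1) by (intro infdist_ge_of_dist_ge) (auto simp: dist_commute)
    with \<open>z \<in> N\<close> d(1) show "z \<in> D" by (auto simp: N_def)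
  qed
  obtain B where B: "\<And>z w. z \<in> N \<Longrightarrow> w \<in> N \<Longrightarrow> kobayashi_dist D z w \<le> B"
    using kobayashi_dist_bounded_on_compact[OF domain assms(1) \<open>compact N\<close> \<open>N \<subseteq> D\<close>] by metis
  have "\<exists>a b \<sigma>. a \<le> b \<and> almost_geodesic (D - A) l \<kappa> {a..b} \<sigma> \<and> \<sigma> a \<in> V \<and> \<sigma> b \<in> W \<and>
          (\<forall>t\<in>{a..b}. infdist (\<sigma> t) A < min (d / 2) (inverse (real (Suc n))))" for n
  proof -
    have "0 < min (d / 2) (inverse (real (Suc n)))" using d(1) by simp
    with neg show ?thesis by (meson linorder_not_le)
  qed
  then obtain a b \<sigma> where ab: "\<And>n. a n \<le> b n"
    and geo: "\<And>n. almost_geodesic (D - A) l \<kappa> {a n..b n} (\<sigma> n)"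
    and V: "\<And>n. \<sigma> n (a n) \<in> V" and W: "\<And>n. \<sigma> n (b n) \<in> W"
    and near: "\<And>n t. t \<in> {a n..b n} \<Longrightarrow> infdist (\<sigma> n t) A < min (d / 2) (inverse (real (Suc n)))"
    by metis
  have in_N: "\<sigma> n t \<in> N" if "t \<in> {a n..b n}" for n t using near[OF that] by (simp add: N_def)
  obtain C where C: "0 < C"
    "\<And>l \<kappa> a b \<sigma>. 0 \<le> l \<Longrightarrow> almost_geodesic (D - A) l \<kappa> {a..b} \<sigma> \<Longrightarrow> (C * l)-lipschitz_on {a..b} \<sigma>"
    using almost_geodesic_lipschitz[OF open_diff bdd] by metis
  have T: "b n - a n \<le> l * (B + \<kappa>)" for n
  proof -
    have ends: "a n \<in> {a n..b n}" "b n \<in> {a n..b n}" using ab by auto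
    have "inverse l * \<bar>b n - a n\<bar> - \<kappa> \<le> kobayashi_dist D (\<sigma> n (a n)) (\<sigma> n (b n))"
      using almost_geodesic_diff[OF geo[of n]] ends unfolding almost_geodesic_def by blast
    also have "\<dots> \<le> B" by (intro B in_N ends)
    finally have "inverse l * (b n - a n) \<le> B + \<kappa>" using ab[of n] by simp
    then show ?thesis using l(1) by (simp add: field_simps)
  qed
  have bd: "bounded (\<Union>n. \<sigma> n ` {a n..b n})"
    using compact_imp_bounded[OF \<open>compact N\<close>] by (rule bounded_subset) (use in_N in blast)
  have lip: "(C * l)-lipschitz_on {a n..b n} (\<sigma> n)" for n using geo l by (intro C(2)) auto
  have near': "infdist (\<sigma> n t) A \<le> inverse (real (Suc n))" if "t \<in> {a n..b n}" for n t
    using near[OF that] by simp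
  obtain g where g: "(C * l)-lipschitz_on {0..l * (B + \<kappa>)} g" "g ` {0..l * (B + \<kappa>)} \<subseteq> A"
      "g 0 \<in> closure V" "g (l * (B + \<kappa>)) \<in> closure W"
    using lipschitz_curves_limit[OF lip ab T compact_imp_closed[OF compact_A] A(1)
        compact_imp_bounded[OF compact_A] near' bd V W] by metis
  \<comment> \<open>Constancy would put one point into the closures of both \<open>V\<close> and
    \<open>W\<close>.\<close>
  have "g constant_on {0..l * (B + \<kappa>)}"
    using g(1,2) by (intro curves) (auto simp: is_interval_cc)
  moreover have "0 \<le> l * (B + \<kappa>)" using ab[of 0] T[of 0] by linarith
  ultimately have "g 0 = g (l * (B + \<kappa>))" unfolding constant_on_def by (metis atLeastAtMost_iff order_refl)
  with g(3,4) VW show False by auto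
qed

text \<open>The compact set consists of the points at distance at least \<open>e\<close> from both
  \<open>A\<close> and the complement of \<open>D\<close>. A curve that misses it is covered by the
  two open \<open>e\<close>-neighbourhoods; these are disjoint, so its connected image lies in one
  of them, and each of the two possibilities has been excluded for small \<open>e\<close>.\<close>

lemma visibility_domain_diff:
  assumes vis: "visibility_domain D" and A: "A \<noteq> {}" "A \<subseteq> D"
    and curves: "\<And>(I :: real set) (\<phi> :: real \<Rightarrow> complex ^ 'n).
           is_interval I \<Longrightarrow> \<phi> ` I \<subseteq> A \<Longrightarrow> (\<exists>L. L-lipschitz_on I \<phi>) \<Longrightarrow> \<phi> constant_on I"
  shows "visibility_domain (D - A)"
proof -
  have "bounded D" using vis by (simp add: visibility_domain_def)
  then have bdd: "bounded (D - A)" by (rule bounded_subset) blast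
  have ne: "- D \<noteq> {}" using \<open>bounded D\<close> not_bounded_UNIV by (metis Compl_empty_eq double_complement)
  have cl: "closed (- D)" using open_D by (rule closed_Compl)
  obtain d where d: "0 < d" "\<And>x y. x \<in> A \<Longrightarrow> y \<in> - D \<Longrightarrow> d \<le> dist x y"
    using separate_compact_closed[OF compact_A cl] A(2) by blast
  obtain C where C: "0 < C"
    "\<And>l \<kappa> a b \<sigma>. 0 \<le> l \<Longrightarrow> almost_geodesic (D - A) l \<kappa> {a..b} \<sigma> \<Longrightarrow> (C * l)-lipschitz_on {a..b} \<sigma>"
    using almost_geodesic_lipschitz[OF open_diff bdd] by metis
  have main: "\<exists>K. compact K \<and> K \<subseteq> D - A \<and> (\<forall>a b \<sigma>. a \<le> b \<and> almost_geodesic (D - A) l \<kappa> {a..b} \<sigma> \<and>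
          \<sigma> a \<in> V \<and> \<sigma> b \<in> W \<longrightarrow> \<sigma> ` {a..b} \<inter> K \<noteq> {})"
    if l: "1 \<le> l" "0 \<le> \<kappa>" and VW: "openin (top_of_set (closure (D - A))) V"
      "openin (top_of_set (closure (D - A))) W" "closure V \<inter> closure W = {}" for l \<kappa> V W
  proof -
    have "V \<subseteq> closure (D - A)" "W \<subseteq> closure (D - A)"
      using VW(1,2) openin_imp_subset by blast+
    then have VW': "V \<subseteq> closure D" "W \<subseteq> closure D" using closure_mono[of "D - A" D] by blast+
    obtain e1 where e1: "0 < e1" "\<And>a b \<sigma>. a \<le> b \<Longrightarrow> almost_geodesic (D - A) l \<kappa> {a..b} \<sigma> \<Longrightarrow>
        \<sigma> a \<in> V \<Longrightarrow> \<sigma> b \<in> W \<Longrightarrow> \<exists>t\<in>{a..b}. e1 \<le> infdist (\<sigma> t) (- D)"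
      using no_almost_geodesics_near_boundary[OF vis l VW' VW(3)] by blast
    obtain e2 where e2: "0 < e2" "\<And>a b \<sigma>. a \<le> b \<Longrightarrow> almost_geodesic (D - A) l \<kappa> {a..b} \<sigma> \<Longrightarrow>
        \<sigma> a \<in> V \<Longrightarrow> \<sigma> b \<in> W \<Longrightarrow> \<exists>t\<in>{a..b}. e2 \<le> infdist (\<sigma> t) A"
      using no_almost_geodesics_near_removed_set[OF \<open>bounded D\<close> l A curves VW(3)] by blast
    \<comment> \<open>The bound \<open>d / 2\<close> makes the two neighbourhoods disjoint,
      \<open>e1\<close> and \<open>e2\<close> exclude curves that stay in one of them.\<close>
    define e where "e = min (d / 2) (min e1 e2)"
    have e: "0 < e" "e \<le> d / 2" "e \<le> e1" "e \<le> e2" using d(1) e1(1) e2(1) by (auto simp: e_def)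
    define K where "K = {z. e \<le> infdist z (- D)} \<inter> {z. e \<le> infdist z A}"
    have "K \<subseteq> D - A"
    proof
      fix z assume "z \<in> K"
      then have "infdist z (- D) \<noteq> 0" "infdist z A \<noteq> 0" using e(1) by (auto simp: K_def)
      then show "z \<in> D - A" by (metis ComplI DiffI infdist_zero)
    qed
    moreover have "closed K" unfolding K_def
      by (intro closed_Int closed_Collect_le continuous_intros)
    ultimately have "compact K" using bdd by (meson bounded_subset compact_eq_bounded_closed)
    moreover have "\<sigma> ` {a..b} \<inter> K \<noteq> {}"
      if ab: "a \<le> b" and geo: "almost_geodesic (D - A) l \<kappa> {a..b} \<sigma>" and ends: "\<sigma> a \<in> V" "\<sigma> b \<in> W" for a b \<sigma>
    proof
      assume empty: "\<sigma> ` {a..b} \<inter> K = {}"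
      let ?X = "\<sigma> ` {a..b}" and ?P = "{z. infdist z (- D) < e}" and ?Q = "{z. infdist z A < e}"
      have "continuous_on {a..b} \<sigma>"
        using C(2)[OF _ geo] l(1) by (intro lipschitz_on_continuous_on) auto
      then have "connected ?X" by (intro connected_continuous_image) auto
      moreover have "open ?P" "open ?Q" by (intro open_Collect_less continuous_intros)+
      moreover have "?X \<subseteq> ?P \<union> ?Q"
      proof
        fix x assume "x \<in> ?X"
        then have "x \<notin> K" using empty by blast
        then show "x \<in> ?P \<union> ?Q" by (auto simp: K_def not_le)
      qed
      moreover have "?P \<inter> ?Q \<inter> ?X = {}"
      proof -
        have False if x: "infdist x (- D) < e" "infdist x A < e" for x
        proof -
          obtain y where y: "y \<in> - D" "infdist x (- D) = dist x y"
            using infdist_attains_inf[OF cl ne] by metis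
          obtain z where z: "z \<in> A" "infdist x A = dist x z"
            using infdist_attains_inf[OF compact_imp_closed[OF compact_A] A(1)] by metis
          show False using d(2)[OF z(1) y(1)] dist_triangle3[of z y x] x y(2) z(2) e(2) by linarith
        qed
        then show ?thesis by blast
      qed
      ultimately have "?P \<inter> ?X = {} \<or> ?Q \<inter> ?X = {}"
        using connectedD[of ?X ?P ?Q] by simp
      then show False
      proof
        assume "?P \<inter> ?X = {}"
        obtain t where t: "t \<in> {a..b}" "e2 \<le> infdist (\<sigma> t) A" using e2(2)[OF ab geo ends] by blast
        have "\<sigma> t \<in> K" using \<open>?P \<inter> ?X = {}\<close> t e(4) by (force simp: K_def not_less)
        with t(1) empty show False by blast
      next
        assume "?Q \<inter> ?X = {}"
        obtain t where t: "t \<in> {a..b}" "e1 \<le> infdist (\<sigma> t) (- D)" using e1(2)[OF ab geo ends] by blast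
        have "\<sigma> t \<in> K" using \<open>?Q \<inter> ?X = {}\<close> t e(3) by (force simp: K_def not_less)
        with t(1) empty show False by blast
      qed
    qed
    ultimately show ?thesis using \<open>K \<subseteq> D - A\<close> by (intro exI[of _ K]) blast
  qed
  show ?thesis
    unfolding visibility_domain_def
    by (intro conjI domain_diff bdd allI impI, elim conjE) (rule main)
qed

section \<open>Failure of pseudoconvexity and completeness\<close>

text \<open>If \<open>z + \<zeta> *s w\<close> is a point \<open>a\<close> of \<open>A\<close> with
  \<open>\<zeta> \<noteq> 0\<close>, then \<open>w\<close> is a complex multiple of
  \<open>a - z\<close>. Such vectors form a negligible cone.\<close>

lemma line_meeting_only_at:
  assumes "0 < r"
  obtains w where "norm w < r" "\<And>\<zeta>. \<zeta> \<noteq> 0 \<Longrightarrow> z + \<zeta> *s w \<notin> A"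
proof -
  define N where "N = {\<zeta> *s (a - z) | \<zeta> a. a \<in> A}"
  have "negligible N" unfolding N_def
    using card_ge_2 compact_A by (intro negligible_complex_cone[OF null]) (auto intro: compact_imp_bounded)
  then obtain w where w: "w \<notin> N" "norm w < r"
    using negligible_avoid_small[OF _ assms] by metis
  show ?thesis
  proof (rule that[OF w(2)], rule notI)
    fix \<zeta> :: complex assume "\<zeta> \<noteq> 0" "z + \<zeta> *s w \<in> A"
    moreover from \<open>\<zeta> \<noteq> 0\<close> have "w = inverse \<zeta> *s (z + \<zeta> *s w - z)"
      by (simp add: vector_smult_assoc)
    ultimately show False using w(1) unfolding N_def by blast
  qed
qed

text \<open>The discs \<open>z + c + \<zeta> *s w\<close> with \<open>\<bar>\<zeta>\<bar> \<le> 1\<close> avoid \<open>A\<close> for almost every small \<open>c\<close>; their boundary circles stay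
  in a fixed compact subset of \<open>D - A\<close> while their centres approach \<open>z \<in> A\<close>.\<close>

lemma not_pseudoconvex_diff:
  assumes "A \<noteq> {}" "A \<subseteq> D"
  shows "\<not> pseudoconvex (D - A)"
proof
  assume "pseudoconvex (D - A)"
  then obtain u where psh: "continuous_psh_on (D - A) u"
    and exh: "\<forall>c. compact (closure {z\<in>D - A. u z < c}) \<and> closure {z\<in>D - A. u z < c} \<subseteq> D - A"
    unfolding pseudoconvex_def by blast
  have cont: "continuous_on (D - A) u" using psh unfolding continuous_psh_on_def by blast
  have mean: "u z \<le> 1 / (2 * pi) * integral {0..2 * pi} (\<lambda>\<theta>. u (z + cis \<theta> *s w))"
      if "\<forall>\<zeta>\<in>cball 0 1. z + \<zeta> *s w \<in> D - A" for z w
    using psh that unfolding continuous_psh_on_def by blast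
  obtain z where z: "z \<in> A" using assms(1) by blast
  then obtain r where r: "0 < r" "ball z r \<subseteq> D"
    using open_D assms(2) by (meson open_contains_ball subsetD)
  obtain w where w: "norm w < r" "\<And>\<zeta>. \<zeta> \<noteq> 0 \<Longrightarrow> z + \<zeta> *s w \<notin> A"
    using line_meeting_only_at[OF r(1), of z] by metis
  have contw: "continuous_on S (\<lambda>x. g x *s w)" if "continuous_on S g" for S :: "real set" and g
    by (rule bounded_linear.continuous_on[OF bounded_linear_vector_scalar_mult_left that])
  define C where "C = (\<lambda>\<theta>. z + cis \<theta> *s w) ` {0..2 * pi}"
  have "compact C" unfolding C_def
    by (intro compact_continuous_image continuous_intros contw) auto
  have "C \<subseteq> D - A"
  proof
    fix x assume "x \<in> C"
    then obtain \<theta> where x: "x = z + cis \<theta> *s w" by (auto simp: C_def)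
    then have "x \<in> ball z r" using w(1) by (simp add: dist_norm norm_vector_scalar_mult)
    with r(2) w(2)[of "cis \<theta>"] x show "x \<in> D - A" by auto
  qed
  obtain d where d: "0 < d" "\<And>x c. x \<in> C \<Longrightarrow> norm c < d \<Longrightarrow> x + c \<in> D - A"
    using compact_translation_subset[OF \<open>compact C\<close> open_diff \<open>C \<subseteq> D - A\<close>] by metis
  \<comment> \<open>The circle thickened by \<open>d / 2\<close> contains all boundary circles of
    the translated discs, so one maximum \<open>M\<close> of \<open>u\<close> bounds them
    all.\<close>
  define K where "K = {x + c | x c. x \<in> C \<and> c \<in> cball 0 (d / 2)}"
  have "compact K" unfolding K_def using \<open>compact C\<close> by (intro compact_sums) auto
  have "K \<subseteq> D - A" using d by (force simp: K_def)
  then have "compact (u ` K)"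
    using cont \<open>compact K\<close> by (meson compact_continuous_image continuous_on_subset)
  then have "bdd_above (u ` K)" by (intro bounded_imp_bdd_above compact_imp_bounded)
  then obtain M where M: "\<And>x. x \<in> K \<Longrightarrow> u x \<le> M" by (auto simp: bdd_above_def)
  have lip: "(norm w)-lipschitz_on (cball 0 1) (\<lambda>\<zeta>. z + \<zeta> *s w)"
  proof (rule lipschitz_onI)
    fix \<zeta> \<zeta>' :: complex
    have "z + \<zeta> *s w - (z + \<zeta>' *s w) = (\<zeta> - \<zeta>') *s w" by (simp add: vec_eq_iff algebra_simps)
    then have "norm (z + \<zeta> *s w - (z + \<zeta>' *s w)) = norm w * cmod (\<zeta> - \<zeta>')"
      by (simp only: norm_vector_scalar_mult mult.commute)
    then show "dist (z + \<zeta> *s w) (z + \<zeta>' *s w) \<le> norm w * dist \<zeta> \<zeta>'"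
      by (simp only: dist_norm)
  qed simp
  define N where "N = {c. \<exists>\<zeta>\<in>cball 0 1. z + \<zeta> *s w + c \<in> A}"
  have N: "negligible N" unfolding N_def by (rule negligible_translations[OF bounded_cball lip])
  \<comment> \<open>This contradicts the exhaustion property, as \<open>z\<close> lies in
    \<open>A\<close>. The level is \<open>M + 1\<close> because sublevel sets are strict while the
    mean value inequality only gives \<open>u (z + c) \<le> M\<close>.\<close>
  have "z \<in> closure {z\<in>D - A. u z < M + 1}"
    unfolding closure_approachable
  proof (intro allI impI)
    fix e :: real assume "0 < e"
    \<comment> \<open>The three bounds bring the centre within \<open>e\<close> of \<open>z\<close>,
      keep the boundary circle in \<open>K\<close>, and keep the whole disc in the ball of radius
      \<open>r\<close> around \<open>z\<close>.\<close>
    then have "0 < min e (min (d / 2) (r - norm w))" using d(1) w(1) by simp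
    from negligible_avoid_small[OF N this]
    obtain c where c: "c \<notin> N" "norm c < min e (min (d / 2) (r - norm w))" by metis
    have disc: "z + c + \<zeta> *s w \<in> D - A" if "\<zeta> \<in> cball 0 1" for \<zeta>
    proof -
      have "norm (\<zeta> *s w + c) \<le> cmod \<zeta> * norm w + norm c"
        by (metis norm_triangle_ineq norm_vector_scalar_mult)
      also have "\<dots> \<le> 1 * norm w + norm c" using that by (intro add_right_mono mult_right_mono) auto
      also have "\<dots> < r" using c(2) by simp
      finally have "norm (\<zeta> *s w + c) < r" .
      moreover have "dist z (z + v) = norm v" for v by (simp add: dist_norm)
      ultimately have "z + (\<zeta> *s w + c) \<in> ball z r" by (simp only: mem_ball)
      moreover have "z + \<zeta> *s w + c \<notin> A" using c(1) that by (auto simp: N_def)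
      ultimately show ?thesis using r(2) by (auto simp: add_ac)
    qed
    have cint: "continuous_on {0..2 * pi} (\<lambda>\<theta>. u (z + c + cis \<theta> *s w))"
    proof (rule continuous_on_compose2[OF cont])
      show "continuous_on {0..2 * pi} (\<lambda>\<theta>. z + c + cis \<theta> *s w)"
        by (intro continuous_intros contw)
    qed (use disc in auto)
    have le: "u (z + c + cis \<theta> *s w) \<le> M" if "\<theta> \<in> {0..2 * pi}" for \<theta>
    proof (rule M)
      have "z + c + cis \<theta> *s w = (z + cis \<theta> *s w) + c" by simp
      moreover have "z + cis \<theta> *s w \<in> C" using that by (auto simp: C_def)
      moreover have "c \<in> cball 0 (d / 2)" using c(2) by simp
      ultimately show "z + c + cis \<theta> *s w \<in> K" unfolding K_def by blast
    qed
    have "integral {0..2 * pi} (\<lambda>\<theta>. u (z + c + cis \<theta> *s w)) \<le> integral {0..2 * pi} (\<lambda>\<theta>::real. M)"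
      using le by (intro integral_le integrable_continuous_real cint continuous_on_const) auto
    then have "1 / (2 * pi) * integral {0..2 * pi} (\<lambda>\<theta>. u (z + c + cis \<theta> *s w)) \<le> M"
      by (simp add: field_simps)
    with mean[of "z + c" w] disc have "u (z + c) \<le> M" by fastforce
    moreover have "z + c \<in> D - A" using disc[of 0] by simp
    ultimately show "\<exists>y\<in>{z\<in>D - A. u z < M + 1}. dist y z < e"
      using c(2) by (intro bexI[of _ "z + c"]) (auto simp: dist_norm)
  qed
  with exh z show False by blast
qed

text \<open>Argued by a sequence rather than through pseudoconvexity. A Kobayashi limit in
  \<open>D - A\<close> would also be the Euclidean limit, because the Kobayashi distance dominates a
  multiple of the Euclidean one; but the Euclidean limit is \<open>z\<close>, a point of
  \<open>A\<close>.\<close>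

lemma not_kobayashi_complete_diff:
  assumes "A \<noteq> {}" "A \<subseteq> D" "bounded D"
  shows "\<not> kobayashi_complete (D - A)"
proof
  have bdd: "bounded (D - A)" using assms(3) by (rule bounded_subset) blast
  interpret M: Metric_space "D - A" "kobayashi_dist (D - A)"
    using Metric_space_kobayashi_dist[OF domain_diff bdd] .
  assume "kobayashi_complete (D - A)"
  then have complete: "M.mcomplete" by (simp add: kobayashi_complete_def)
  obtain z where z: "z \<in> A" "z \<in> D" using assms by blast
  have "\<exists>y. y \<in> D - A \<and> dist z y < inverse (real (Suc n)) \<and> kobayashi_dist D z y < inverse (real (Suc n))" for n
  proof -
    have pos: "0 < inverse (real (Suc n))" by simp
    obtain d where d: "0 < d" "\<And>w. dist z w < d \<Longrightarrow> kobayashi_dist D z w < inverse (real (Suc n))"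
      using kobayashi_dist_small[OF open_D z(2) pos] by metis
    have "0 < min d (inverse (real (Suc n)))" using d(1) by simp
    then obtain y where "y \<in> D - A" "dist z y < min d (inverse (real (Suc n)))"
      using approximable_from_diff[OF z(2)] by metis
    with d(2)[of y] show ?thesis by auto
  qed
  then obtain y where y: "\<And>n. y n \<in> D - A" "\<And>n. dist z (y n) < inverse (real (Suc n))"
      "\<And>n. kobayashi_dist D z (y n) < inverse (real (Suc n))"
    by metis
  have "M.MCauchy y"
    unfolding M.MCauchy_def
  proof (intro conjI allI impI)
    fix e :: real assume "0 < e"
    then obtain k where k: "inverse (real (Suc k)) < e / 2" using reals_Archimedean[of "e / 2"] by auto
    have "kobayashi_dist (D - A) (y m) (y n) < e" if "k \<le> m" "k \<le> n" for m n
    proof -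
      have le: "inverse (real (Suc j)) \<le> inverse (real (Suc k))" if "k \<le> j" for j
        using that by (intro le_imp_inverse_le) auto
      \<comment> \<open>The triangle inequality through \<open>z\<close> is possible for the
        distance of \<open>D\<close> only, since \<open>z\<close> has been removed from
        \<open>D - A\<close>.\<close>
      have "kobayashi_dist (D - A) (y m) (y n) = kobayashi_dist D (y m) (y n)"
        by (rule kobayashi_dist_diff[OF y(1) y(1)])
      also have "\<dots> \<le> kobayashi_dist D (y m) z + kobayashi_dist D z (y n)"
        using y(1) z(2) by (intro kobayashi_dist_triangle[OF domain]) auto
      also have "\<dots> = kobayashi_dist D z (y m) + kobayashi_dist D z (y n)"
        by (simp add: kobayashi_dist_commute)
      finally show ?thesis using y(3)[of m] y(3)[of n] le[OF that(1)] le[OF that(2)] k by linarith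
    qed
    then show "\<exists>N. \<forall>n n'. N \<le> n \<longrightarrow> N \<le> n' \<longrightarrow> kobayashi_dist (D - A) (y n) (y n') < e" by blast
  qed (use y(1) in blast)
  then obtain x where "limitin M.mtopology y x sequentially"
    using complete unfolding M.mcomplete_def by blast
  then have x: "x \<in> D - A" "\<And>e. 0 < e \<Longrightarrow> \<exists>N. \<forall>n\<ge>N. kobayashi_dist (D - A) (y n) x < e"
    unfolding M.limit_metric_sequentially by metis+
  obtain C where C: "0 < C" "\<And>z w. z \<in> D - A \<Longrightarrow> w \<in> D - A \<Longrightarrow> dist z w \<le> C * kobayashi_dist (D - A) z w"
    using dist_le_kobayashi_dist[OF domain_diff bdd] by metis
  have "dist z x \<le> 0 + e" if "0 < e" for e
  proof -
    have "0 < e / (2 * C)" using \<open>0 < e\<close> C(1) by simp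
    then obtain N where N: "\<forall>n\<ge>N. kobayashi_dist (D - A) (y n) x < e / (2 * C)" using x(2) by blast
    obtain k where k: "inverse (real (Suc k)) < e / 2" using reals_Archimedean[of "e / 2"] \<open>0 < e\<close> by auto
    define m where "m = max N k"
    have "dist (y m) x \<le> C * kobayashi_dist (D - A) (y m) x" by (rule C(2)[OF y(1) x(1)])
    also have "\<dots> \<le> C * (e / (2 * C))" using N C(1) by (intro mult_left_mono) (auto simp: m_def less_imp_le)
    also have "\<dots> = e / 2" using C(1) by simp
    finally have "dist (y m) x \<le> e / 2" .
    moreover have "inverse (real (Suc m)) \<le> inverse (real (Suc k))"
      by (intro le_imp_inverse_le) (auto simp: m_def)
    ultimately show ?thesis using y(2)[of m] k dist_triangle[of z x "y m"] by linarith
  qed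
  then have "dist z x \<le> 0" by (rule field_le_epsilon)
  with x(1) z(1) show False by simp
qed

end

theorem theorem1p3:
  fixes D A :: "(complex ^ 'n) set"
  assumes "CARD('n) \<ge> 2"
    and "visibility_domain D"
    and "compact A" and "A \<noteq> {}" and "A \<subseteq> D"
    and "hausdorff_measure (2 * real CARD('n) - 2) A = 0"
    and "\<And>(I :: real set) (\<phi> :: real \<Rightarrow> complex ^ 'n).
           is_interval I \<Longrightarrow> \<phi> ` I \<subseteq> A \<Longrightarrow> (\<exists>L. L-lipschitz_on I \<phi>) \<Longrightarrow> \<phi> constant_on I"
  shows "visibility_domain (D - A) \<and> \<not> pseudoconvex (D - A) \<and> \<not> kobayashi_complete (D - A)"
proof -
  have "is_domain D" "bounded D" using assms(2) by (auto simp: visibility_domain_def)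
  interpret hausdorff_null_removal D A
    by unfold_locales fact+
  show ?thesis
    using visibility_domain_diff[OF assms(2,4,5,7)] not_pseudoconvex_diff[OF assms(4,5)]
      not_kobayashi_complete_diff[OF assms(4,5) \<open>bounded D\<close>] by simp
qed

end
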